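(* (1) The monoid $M_{2,1}$ is a homomorphic image of a submonoid of $\mathsf{tot}M_{2,1}$. More precisely, let $$F_0=\{f\in\mathsf{tot}M_{2,1}:\ f(0z)=0z\text{ for all }z\in\{0,1\}^\omega\}\subseteq\mathsf{tot}M_{2,1},$$ let $\rho(f)=f\cap(1\{0,1\}^\omega\times1\{0,1\}^\omega)$ for $f\in F_0$, and let $\iota$ map each element $\rho(f)$ to the partial function on $\{0,1\}^\omega$ that sends $z$ to $y$ iff $\rho(f)$ sends $1z$ to $1y$. Then $\rho$ is a surjective monoid homomorphism from $F_0$ onto $\{\rho(f)\in M_{2,1}:f\in F_0\}$, $\iota$ is a monoid isomorphism from $\rho(F_0)$ onto $M_{2,1}$, and hence $\varrho=\iota\circ\rho:F_0\to M_{2,1}$ is a surjective monoid homomorphism. The restriction of $\varrho$ to $\varrho^{-1}(\mathsf{tot}M_{2,1})$ is injective. (2) The monoid $\mathsf{plep}M_{2,1}$ is a homomorphic image of a submonoid of $\mathsf{tlep}M_{2,1}$. More precisely, let $$S_0=\{f\in\mathsf{tlep}M_{2,1}:\ f(0z)\in0\{0,1\}^\omega\text{ for all }z\in\{0,1\}^\omega\}\subseteq\mathsf{tlep}M_{2,1}.$$ Then, with $\rho$ and $\iota$ given by the same formulas on $S_0$, $\rho$ is a surjective monoid homomorphism from $S_0$ onto $\{\rho(f)\in\mathsf{plep}M_{2,1}:f\in S_0\}$, $\iota$ is a monoid isomorphism from $\rho(S_0)$ onto $\mathsf{plep}M_{2,1}$, and $\varrho=\iota\circ\rho:S_0\to\mathsf{plep}M_{2,1}$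 is a surjective monoid homomorphism. (3) The same results hold for $\mathcal{RM}^{\mathsf{fin}}$ (instead of $M_{2,1}$) and $\mathsf{pfl}\mathcal{RM}^{\mathsf{fin}}$ (instead of $\mathsf{plep}M_{2,1}$), with $\mathsf{tot}\mathcal{RM}^{\mathsf{fin}}$ in place of $\mathsf{tot}M_{2,1}$, $\mathsf{tfl}\mathcal{RM}^{\mathsf{fin}}$ in place of $\mathsf{tlep}M_{2,1}$, and $\{0,1\}^*$ in place of $\{0,1\}^\omega$ (conditions on $f(0z)$ being required where $f$ is defined).
   Context: The alphabet is $\{0,1\}$. A prefix code is a set of strings none of which is a proper prefix of another. A right-ideal morphism is a partial function $f:\{0,1\}^*\to\{0,1\}^*$ whose domain is a right ideal (a set $R$ with $R=R\{0,1\}^*$) and such that $f(xu)=f(x)u$ for all $x\in\mathrm{Dom}(f)$, $u\in\{0,1\}^*$; $\mathrm{domC}(f)$ is the unique prefix code with $\mathrm{Dom}(f)=\mathrm{domC}(f)\{0,1\}^*$. $\mathcal{RM}^{\mathsf{fin}}$ is the monoid under composition of right-ideal morphisms with finite domain code; $\mathsf{tot}\mathcal{RM}^{\mathsf{fin}}$ consists of those with $\mathrm{domC}(f)$ a maximal prefix code. $f$ is plep if $|x_1|=|x_2|$ implies $|f(x_1)|=|f(x_2)|$ for all $x_1,x_2\in\mathrm{Dom}(f)$; tlep means plep and total (maximal domain code); pfl means plep with $\mathrm{domC}(f)\subseteq\{0,1\}^m$ for some $m$; tfl means tlep with $\mathrm{domC}(f)=\{0,1\}^m$ for some $m$. The corresponding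 submonoids of $\mathcal{RM}^{\mathsf{fin}}$ are indicated by prefixes. $f\equiv_{\rm fin}g$ iff the symmetric difference of $\mathrm{Dom}(f)$ and $\mathrm{Dom}(g)$ is finite and $f,g$ agree on $\mathrm{Dom}(f)\cap\mathrm{Dom}(g)$; this is a congruence. $M_{2,1}=\mathcal{RM}^{\mathsf{fin}}/\!\equiv_{\rm fin}$; its elements are identified with partial functions on $\{0,1\}^\omega$ via $f(xz)=f(x)z$ ($x\in\mathrm{Dom}(f)$, $z\in\{0,1\}^\omega$). $\mathsf{tot}M_{2,1}$, $\mathsf{plep}M_{2,1}$, $\mathsf{tlep}M_{2,1}$ are the submonoids of elements represented by total, plep, tlep morphisms respectively. Partial functions are identified with their graphs, so $f\cap(X\times Y)$ is the restriction of $f$ to arguments in $X$ with values in $Y$.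
   Formalization: In (3), injectivity of ϱ on ϱ^{-1}(tot RM^fin) is false (the identity and its restriction to nonempty words have the same image); it is replaced by: elements of F_0 with equal total image are ≡_fin-equivalent and coincide on 1{0,1}^*. *)

theory Defs
  imports "HOL-Library.Sublist" "HOL-Library.Stream" "HOL-Algebra.Group"
begin

text \<open>The letters 0 and 1 are \<^term>\<open>False\<close> and \<^term>\<open>True\<close>; finite words are boolean lists,
  infinite words boolean streams, and partial functions are maps.  Functions act on the left, so
  \<open>f \<circ>\<^sub>m g\<close> applies \<open>g\<close> first.\<close>

section \<open>Right-ideal morphisms\<close>

definition gen_ideal :: "bool list set \<Rightarrow> bool list set" where
  "gen_ideal P = {x @ u | x u. x \<in> P}"

definition right_ideal :: "bool list set \<Rightarrow> bool" where
  "right_ideal R \<longleftrightarrow> R = gen_ideal R"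

definition prefix_code :: "bool list set \<Rightarrow> bool" where
  "prefix_code P \<longleftrightarrow> (\<forall>x\<in>P. \<forall>y\<in>P. \<not> strict_prefix x y)"

definition maximal_prefix_code :: "bool list set \<Rightarrow> bool" where
  "maximal_prefix_code P \<longleftrightarrow> prefix_code P \<and> (\<forall>Q. prefix_code Q \<and> P \<subseteq> Q \<longrightarrow> Q = P)"

definition ri_morphism :: "(bool list \<rightharpoonup> bool list) \<Rightarrow> bool" where
  "ri_morphism f \<longleftrightarrow> right_ideal (dom f) \<and>
     (\<forall>x\<in>dom f. \<forall>u. f (x @ u) = Some (the (f x) @ u))"

definition domC :: "(bool list \<rightharpoonup> bool list) \<Rightarrow> bool list set" where
  "domC f = (THE P. prefix_code P \<and> dom f = gen_ideal P)"

definition RMfin :: "(bool list \<rightharpoonup> bool list) set" where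
  "RMfin = {f. ri_morphism f \<and> finite (domC f)}"

definition totRMfin :: "(bool list \<rightharpoonup> bool list) set" where
  "totRMfin = {f \<in> RMfin. maximal_prefix_code (domC f)}"

definition plep :: "(bool list \<rightharpoonup> bool list) \<Rightarrow> bool" where
  "plep f \<longleftrightarrow> (\<forall>x1\<in>dom f. \<forall>x2\<in>dom f.
     length x1 = length x2 \<longrightarrow> length (the (f x1)) = length (the (f x2)))"

definition plepRMfin :: "(bool list \<rightharpoonup> bool list) set" where
  "plepRMfin = {f \<in> RMfin. plep f}"

definition tlepRMfin :: "(bool list \<rightharpoonup> bool list) set" where
  "tlepRMfin = {f \<in> totRMfin. plep f}"

definition pflRMfin :: "(bool list \<rightharpoonup> bool list) set" where
  "pflRMfin = {f \<in> plepRMfin. \<exists>m. domC f \<subseteq> {x. length x = m}}"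

definition tflRMfin :: "(bool list \<rightharpoonup> bool list) set" where
  "tflRMfin = {f \<in> tlepRMfin. \<exists>m. domC f = {x. length x = m}}"

section \<open>The Thompson monoid\<close>

definition fin_equiv :: "((bool list \<rightharpoonup> bool list) \<times> (bool list \<rightharpoonup> bool list)) set" where
  "fin_equiv = {(f, g). f \<in> RMfin \<and> g \<in> RMfin \<and>
     finite ((dom f - dom g) \<union> (dom g - dom f)) \<and> (\<forall>x \<in> dom f \<inter> dom g. f x = g x)}"

text \<open>The abstract monoid of \<open>\<equiv>\<^sub>f\<^sub>i\<^sub>n\<close>-classes.\<close>

definition M21_quotient :: "(bool list \<rightharpoonup> bool list) set monoid" where
  "M21_quotient = \<lparr>carrier = RMfin // fin_equiv,
     mult = (\<lambda>A B. \<Union>f\<in>A. \<Union>g\<in>B. fin_equiv `` {f \<circ>\<^sub>m g}),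
     one = fin_equiv `` {Some}\<rparr>"

text \<open>The action \<open>f(xz) = f(x)z\<close> on infinite words, and the resulting identification of a class
  with a partial function on infinite words.\<close>

definition on_ends :: "(bool list \<rightharpoonup> bool list) \<Rightarrow> (bool stream \<rightharpoonup> bool stream)" where
  "on_ends f w =
     (if \<exists>x y z. f x = Some y \<and> w = x @- z
      then Some (THE v. \<exists>x y z. f x = Some y \<and> w = x @- z \<and> v = y @- z) else None)"

definition class_on_ends ::
  "(bool list \<rightharpoonup> bool list) set \<Rightarrow> (bool stream \<rightharpoonup> bool stream)" where
  "class_on_ends C = the_elem (on_ends ` C)"

definition M21 :: "(bool stream \<rightharpoonup> bool stream) set" where
  "M21 = class_on_ends ` (RMfin // fin_equiv)"

definition represented_by ::
  "(bool list \<rightharpoonup> bool list) set \<Rightarrow> (bool stream \<rightharpoonup> bool stream) set" where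
  "represented_by N = class_on_ends ` {C \<in> RMfin // fin_equiv. C \<inter> N \<noteq> {}}"

definition totM21 :: "(bool stream \<rightharpoonup> bool stream) set" where
  "totM21 = represented_by totRMfin"

definition plepM21 :: "(bool stream \<rightharpoonup> bool stream) set" where
  "plepM21 = represented_by plepRMfin"

definition tlepM21 :: "(bool stream \<rightharpoonup> bool stream) set" where
  "tlepM21 = represented_by tlepRMfin"

section \<open>Monoids of partial functions and their homomorphisms\<close>

text \<open>The identity element is a parameter because the corner monoids \<open>\<rho>(F\<^sub>0)\<close> below are closed
  under composition but have the idempotent \<open>\<rho>(id)\<close>, not \<open>id\<close>, as their identity.\<close>

definition comp_monoid :: "('a \<rightharpoonup> 'a) set \<Rightarrow> ('a \<rightharpoonup> 'a) \<Rightarrow> ('a \<rightharpoonup> 'a) monoid" where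
  "comp_monoid A e = \<lparr>carrier = A, mult = (\<lambda>f g. f \<circ>\<^sub>m g), one = e\<rparr>"

text \<open>\<^const>\<open>hom\<close> does not include preservation of the identity.\<close>

definition monoid_epi ::
  "('a, 'c) monoid_scheme \<Rightarrow> ('b, 'd) monoid_scheme \<Rightarrow> ('a \<Rightarrow> 'b) \<Rightarrow> bool" where
  "monoid_epi G H h \<longleftrightarrow> monoid G \<and> monoid H \<and> h \<in> epi G H \<and> h \<one>\<^bsub>G\<^esub> = \<one>\<^bsub>H\<^esub>"

definition monoid_iso ::
  "('a, 'c) monoid_scheme \<Rightarrow> ('b, 'd) monoid_scheme \<Rightarrow> ('a \<Rightarrow> 'b) \<Rightarrow> bool" where
  "monoid_iso G H h \<longleftrightarrow> monoid G \<and> monoid H \<and> h \<in> iso G H \<and> h \<one>\<^bsub>G\<^esub> = \<one>\<^bsub>H\<^esub>"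

section \<open>The maps rho and iota and the submonoids\<close>

definition graph_restrict :: "('a \<rightharpoonup> 'b) \<Rightarrow> 'a set \<Rightarrow> 'b set \<Rightarrow> ('a \<rightharpoonup> 'b)" where
  "graph_restrict f X Y = (\<lambda>x. if x \<in> X \<and> (\<exists>y\<in>Y. f x = Some y) then f x else None)"

text \<open>The parameter \<open>c\<close> is the map \<open>z \<mapsto> 1z\<close>, on infinite words \<open>(##) True\<close> and on finite words
  \<open>(#) True\<close>; so \<open>range c\<close> is the set of all words that start with 1.\<close>

definition rho :: "('a \<Rightarrow> 'a) \<Rightarrow> ('a \<rightharpoonup> 'a) \<Rightarrow> ('a \<rightharpoonup> 'a)" where
  "rho c f = graph_restrict f (range c) (range c)"

definition iota :: "('a \<Rightarrow> 'a) \<Rightarrow> ('a \<rightharpoonup> 'a) \<Rightarrow> ('a \<rightharpoonup> 'a)" where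
  "iota c h = (\<lambda>z. if \<exists>y. h (c z) = Some (c y) then Some (THE y. h (c z) = Some (c y)) else None)"

abbreviation "rhoI \<equiv> rho ((##) True)"
abbreviation "iotaI \<equiv> iota ((##) True)"
abbreviation "rhoF \<equiv> rho ((#) True)"
abbreviation "iotaF \<equiv> iota ((#) True)"

definition F0_M :: "(bool stream \<rightharpoonup> bool stream) set" where
  "F0_M = {f \<in> totM21. \<forall>z. f (False ## z) = Some (False ## z)}"

definition S0_M :: "(bool stream \<rightharpoonup> bool stream) set" where
  "S0_M = {f \<in> tlepM21. \<forall>z. \<exists>y. f (False ## z) = Some (False ## y)}"

definition F0_RM :: "(bool list \<rightharpoonup> bool list) set" where
  "F0_RM = {f \<in> totRMfin. \<forall>z. False # z \<in> dom f \<longrightarrow> f (False # z) = Some (False # z)}"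

definition S0_RM :: "(bool list \<rightharpoonup> bool list) set" where
  "S0_RM = {f \<in> tflRMfin. \<forall>z. False # z \<in> dom f \<longrightarrow> (\<exists>y. f (False # z) = Some (False # y))}"

section \<open>Well-definedness of the definite descriptions\<close>

lemma graph_graph_restrict: "Map.graph (graph_restrict f X Y) = Map.graph f \<inter> (X \<times> Y)"
  by (auto simp: Map.graph_def graph_restrict_def split: if_splits)

lemma if_ex_The_eq_Some_iff:
  assumes "\<And>v v'. P v \<Longrightarrow> P v' \<Longrightarrow> v = v'"
  shows "(if \<exists>v. P v then Some (THE v. P v) else None) = Some v \<longleftrightarrow> P v"
proof (cases "\<exists>v. P v")
  case True
  then obtain v' where v': "P v'" ..
  then have "(THE v. P v) = v'" using assms by blast
  with True v' show ?thesis using assms by auto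
qed auto

lemma iota_eq_Some_iff:
  assumes "inj c"
  shows "iota c h z = Some y \<longleftrightarrow> h (c z) = Some (c y)"
  unfolding iota_def by (rule if_ex_The_eq_Some_iff) (metis assms injD option.inject)

lemma gen_ideal_iff: "x \<in> gen_ideal P \<longleftrightarrow> (\<exists>p\<in>P. prefix p x)"
  by (auto simp: gen_ideal_def prefix_def)

lemma prefix_code_subset:
  assumes "prefix_code P" "gen_ideal P = gen_ideal Q"
  shows "P \<subseteq> Q"
proof
  fix p assume p: "p \<in> P"
  then obtain q where q: "q \<in> Q" "prefix q p"
    using assms(2) gen_ideal_iff by (metis prefix_order.order_refl)
  then obtain p' where p': "p' \<in> P" "prefix p' q"
    using assms(2) gen_ideal_iff by (metis prefix_order.order_refl)
  with q p assms(1) have "p' = p"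
    unfolding prefix_code_def strict_prefix_def by (meson prefix_order.order_trans)
  with q p' have "p = q" using prefix_order.antisym by blast
  with q show "p \<in> Q" by simp
qed

lemma prefix_code_exists:
  assumes "right_ideal R"
  shows "\<exists>P. prefix_code P \<and> R = gen_ideal P"
proof (intro exI conjI)
  let ?P = "{x \<in> R. \<forall>y\<in>R. \<not> strict_prefix y x}"
  show "prefix_code ?P" by (auto simp: prefix_code_def)
  have "\<exists>p\<in>?P. prefix p x" if "x \<in> R" for x
    using that
  proof (induction x rule: length_induct)
    case (1 x)
    show ?case
    proof (cases "\<exists>y\<in>R. strict_prefix y x")
      case True
      then show ?thesis using 1 prefix_length_less
        by (metis (lifting) prefix_order.less_imp_le prefix_order.order_trans)
    qed (use 1 in auto)
  qed
  moreover have "x \<in> R" if "p \<in> R" "prefix p x" for p x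
    using that assms unfolding right_ideal_def gen_ideal_iff[symmetric]
    using gen_ideal_iff by blast
  ultimately show "R = gen_ideal ?P" by (auto simp: gen_ideal_iff)
qed

lemma domC_props:
  assumes "right_ideal (dom f)"
  shows "prefix_code (domC f)" "dom f = gen_ideal (domC f)"
proof -
  have "\<exists>!P. prefix_code P \<and> dom f = gen_ideal P"
    using prefix_code_exists[OF assms] prefix_code_subset by (metis subset_antisym)
  from theI'[OF this] show "prefix_code (domC f)" "dom f = gen_ideal (domC f)"
    unfolding domC_def by auto
qed

lemma domC_eqI:
  assumes "prefix_code P" "dom f = gen_ideal P"
  shows "domC f = P"
  unfolding domC_def
  by (rule the_equality) (use assms prefix_code_subset in \<open>metis subset_antisym\<close>)+

lemma ri_morphism_append: "ri_morphism f \<Longrightarrow> f x = Some y \<Longrightarrow> f (x @ u) = Some (y @ u)"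
  unfolding ri_morphism_def by (metis domI option.sel)

lemma ri_morphismI:
  assumes "\<And>x y u. f x = Some y \<Longrightarrow> f (x @ u) = Some (y @ u)"
  shows "ri_morphism f"
proof -
  have "gen_ideal (dom f) \<subseteq> dom f" unfolding gen_ideal_def using assms by auto
  moreover have "dom f \<subseteq> gen_ideal (dom f)" unfolding gen_ideal_iff subset_iff by blast
  ultimately have "right_ideal (dom f)" by (simp add: right_ideal_def)
  then show ?thesis unfolding ri_morphism_def using assms by auto
qed

lemma on_ends_eq_Some_iff:
  assumes "ri_morphism f"
  shows "on_ends f w = Some v \<longleftrightarrow> (\<exists>x y z. f x = Some y \<and> w = x @- z \<and> v = y @- z)"
proof -
  have uniq: "y @- z = y' @- z'"
    if "f x = Some y" "f x' = Some y'" "x @- z = x' @- z'" "length x \<le> length x'" for x y z x' y' z'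
  proof -
    have "x = take (length x) x'"
      using arg_cong[OF that(3), of "stake (length x)"] that(4) by (simp add: stake_shift)
    then obtain u where u: "x' = x @ u" by (metis append_take_drop_id)
    with that(3) have "z = u @- z'" by simp
    moreover have "y' = y @ u" using ri_morphism_append[OF assms that(1), of u] that(2) u by simp
    ultimately show ?thesis by simp
  qed
  let ?P = "\<lambda>v. \<exists>x y z. f x = Some y \<and> w = x @- z \<and> v = y @- z"
  have u: "v = v'" if "?P v" "?P v'" for v v'
  proof -
    from that obtain x y z x' y' z' where
      *: "f x = Some y" "w = x @- z" "v = y @- z" "f x' = Some y'" "w = x' @- z'" "v' = y' @- z'"
      by blast
    show ?thesis
      using uniq[of x y x' y' z z'] uniq[of x' y' x y z' z] * by (cases "length x \<le> length x'") simp_all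
  qed
  have "(\<exists>x y z. f x = Some y \<and> w = x @- z) \<longleftrightarrow> (\<exists>v. ?P v)" by blast
  then have "on_ends f w = (if \<exists>v. ?P v then Some (THE v. ?P v) else None)"
    unfolding on_ends_def by presburger
  then show ?thesis using if_ex_The_eq_Some_iff[of ?P v, OF u] by presburger
qed

section \<open>The identification of classes with partial functions on infinite words\<close>

lemma shift_right_inj:
  assumes "\<And>z. y @- z = (y' :: bool list) @- z"
  shows "y = y'"
proof -
  have aux: "a = b" if le: "length a \<le> length b" and e: "\<And>z. a @- z = (b :: bool list) @- z" for a b
  proof -
    have "a = take (length a) b"
      using arg_cong[OF e, of "stake (length a)"] le by (simp add: stake_shift)
    then obtain u where u: "b = a @ u" by (metis append_take_drop_id)
    then have z: "z = u @- z" for z using e[of z] by simp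
    have "u = []"
    proof (rule ccontr)
      assume "u \<noteq> []"
      then have "shd z = hd u" for z using z[of z] by (metis shift_simps(1))
      from this[of "True ## undefined"] this[of "False ## undefined"] show False by simp
    qed
    with u show ?thesis by simp
  qed
  show ?thesis using aux[of y y'] aux[of y' y] assms nat_le_linear by metis
qed

lemma fin_equiv_on_ends_mono:
  assumes "(f, g) \<in> fin_equiv" "on_ends f w = Some v"
  shows "on_ends g w = Some v"
proof -
  have f: "ri_morphism f" and g: "ri_morphism g" and fin: "finite (dom f - dom g)"
    and eq: "\<forall>x\<in>dom f \<inter> dom g. f x = g x"
    using assms(1) by (auto simp: fin_equiv_def RMfin_def)
  obtain x y z where x: "f x = Some y" "w = x @- z" "v = y @- z"
    using assms(2) on_ends_eq_Some_iff[OF f] by blast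
  have fx: "f (x @ stake n z) = Some (y @ stake n z)" for n
    using ri_morphism_append[OF f x(1)] .
  have "\<exists>n. x @ stake n z \<in> dom g"
  proof (rule ccontr)
    assume "\<nexists>n. x @ stake n z \<in> dom g"
    then have "range (\<lambda>n. x @ stake n z) \<subseteq> dom f - dom g" using fx by auto
    moreover have "inj (\<lambda>n. x @ stake n z)"
      by (rule injI) (metis length_stake same_append_eq)
    ultimately show False using fin finite_subset finite_imageD infinite_UNIV_nat by blast
  qed
  then obtain n where "x @ stake n z \<in> dom g" ..
  with eq fx[of n] have "g (x @ stake n z) = Some (y @ stake n z)" by (metis IntI domI)
  then show ?thesis
    unfolding on_ends_eq_Some_iff[OF g] using x
    by (metis shift_append stake_sdrop)
qed

lemma fin_equiv_sym: "(f, g) \<in> fin_equiv \<Longrightarrow> (g, f) \<in> fin_equiv"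
  by (auto simp: fin_equiv_def Un_commute)

lemma fin_equiv_dom_finite:
  assumes f: "f \<in> RMfin" and g: "g \<in> RMfin" and eq: "on_ends f = on_ends g"
  shows "finite (dom f - dom g)"
proof -
  have rf: "ri_morphism f" and rg: "ri_morphism g" and fin: "finite (domC g)"
    using f g by (auto simp: RMfin_def)
  have rid: "dom g = gen_ideal (domC g)" using domC_props(2) rg by (auto simp: ri_morphism_def)
  obtain N where N: "\<And>p. p \<in> domC g \<Longrightarrow> length p \<le> N"
    using fin by (metis finite_imageI finite_nat_set_iff_bounded_le imageI)
  have "length x \<le> N" if x: "x \<in> dom f" "x \<notin> dom g" for x
  proof -
    define z :: "bool stream" where "z = undefined"
    from x obtain y where "f x = Some y" by auto
    then have "on_ends g (x @- z) = Some (y @- z)"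
      unfolding eq[symmetric] on_ends_eq_Some_iff[OF rf] by blast
    then obtain x' z' where x': "x' \<in> dom g" "x @- z = x' @- z'"
      unfolding on_ends_eq_Some_iff[OF rg] by blast
    then obtain p u where p: "p \<in> domC g" "x' = p @ u"
      using rid by (auto simp: gen_ideal_def)
    then have pz: "x @- z = p @- (u @- z')" using x' by simp
    have "\<not> length p \<le> length x"
    proof
      assume "length p \<le> length x"
      then have "p = take (length p) x"
        using arg_cong[OF pz, of "stake (length p)"] by (simp add: stake_shift)
      then have "x \<in> gen_ideal (domC g)" unfolding gen_ideal_iff using p(1) take_is_prefix by metis
      with rid x show False by simp
    qed
    with N[OF p(1)] show ?thesis by simp
  qed
  then have "dom f - dom g \<subseteq> {x. set x \<subseteq> UNIV \<and> length x \<le> N}" by auto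
  then show ?thesis using finite_lists_length_le[of "UNIV :: bool set" N] finite_subset by auto
qed

lemma fin_equiv_iff_on_ends:
  assumes f: "f \<in> RMfin" and g: "g \<in> RMfin"
  shows "(f, g) \<in> fin_equiv \<longleftrightarrow> on_ends f = on_ends g"
proof
  assume "(f, g) \<in> fin_equiv"
  then have "on_ends f w = Some v \<longleftrightarrow> on_ends g w = Some v" for w v
    using fin_equiv_on_ends_mono fin_equiv_sym by blast
  then show "on_ends f = on_ends g" by (intro ext) (metis not_Some_eq)
next
  assume eq: "on_ends f = on_ends g"
  have rf: "ri_morphism f" and rg: "ri_morphism g" using f g by (auto simp: RMfin_def)
  have "f x = g x" if "x \<in> dom f" "x \<in> dom g" for x
  proof -
    from that obtain y y' where y: "f x = Some y" "g x = Some y'" by auto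
    have "y @- z = y' @- z" for z
    proof -
      have "on_ends f (x @- z) = Some (y @- z)" "on_ends g (x @- z) = Some (y' @- z)"
        using y on_ends_eq_Some_iff[OF rf] on_ends_eq_Some_iff[OF rg] by blast+
      then show ?thesis using eq by simp
    qed
    then show ?thesis using y shift_right_inj by metis
  qed
  moreover have "finite (dom f - dom g)" "finite (dom g - dom f)"
    using fin_equiv_dom_finite f g eq by metis+
  ultimately show "(f, g) \<in> fin_equiv" using f g by (auto simp: fin_equiv_def)
qed

lemma equiv_fin_equiv: "equiv RMfin fin_equiv"
proof (rule equivI)
  show "fin_equiv \<subseteq> RMfin \<times> RMfin" by (auto simp: fin_equiv_def)
  show "refl_on RMfin fin_equiv" by (auto simp: refl_on_def fin_equiv_def)
  show "sym fin_equiv" using fin_equiv_sym by (auto intro: symI)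
  show "trans fin_equiv"
  proof (rule transI)
    fix f g h assume a: "(f, g) \<in> fin_equiv" "(g, h) \<in> fin_equiv"
    then have "f \<in> RMfin" "g \<in> RMfin" "h \<in> RMfin" by (auto simp: fin_equiv_def)
    with a show "(f, h) \<in> fin_equiv" using fin_equiv_iff_on_ends by metis
  qed
qed

lemma class_on_ends: "f \<in> RMfin \<Longrightarrow> class_on_ends (fin_equiv `` {f}) = on_ends f"
proof -
  assume f: "f \<in> RMfin"
  have "on_ends ` (fin_equiv `` {f}) = {on_ends f}"
  proof (intro equalityI subsetI)
    fix h assume "h \<in> on_ends ` (fin_equiv `` {f})"
    then obtain g where "(f, g) \<in> fin_equiv" "h = on_ends g" by auto
    moreover from this have "g \<in> RMfin" by (auto simp: fin_equiv_def)
    ultimately show "h \<in> {on_ends f}" using f fin_equiv_iff_on_ends by auto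
  qed (use f in \<open>auto simp: fin_equiv_def\<close>)
  then show ?thesis by (simp add: class_on_ends_def)
qed

lemma represented_by_eq: "N \<subseteq> RMfin \<Longrightarrow> represented_by N = on_ends ` N"
proof (intro equalityI subsetI)
  fix h assume "N \<subseteq> RMfin" "h \<in> represented_by N"
  then obtain C f where C: "C \<in> RMfin // fin_equiv" "h = class_on_ends C" "f \<in> C" "f \<in> N" "f \<in> RMfin"
    by (auto simp: represented_by_def)
  then have "C = fin_equiv `` {f}"
    using equiv_fin_equiv by (metis Image_singleton_iff equiv_class_eq quotientE)
  then show "h \<in> on_ends ` N" using C class_on_ends by auto
next
  fix h assume "N \<subseteq> RMfin" "h \<in> on_ends ` N"
  then obtain f where f: "f \<in> N" "f \<in> RMfin" "h = on_ends f" by auto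
  then have "f \<in> fin_equiv `` {f}" "fin_equiv `` {f} \<in> RMfin // fin_equiv"
    using equiv_class_self[OF equiv_fin_equiv] quotientI by metis+
  with f(1) have "fin_equiv `` {f} \<in> {C \<in> RMfin // fin_equiv. C \<inter> N \<noteq> {}}" by blast
  moreover have "h = class_on_ends (fin_equiv `` {f})" using f class_on_ends by metis
  ultimately show "h \<in> represented_by N"
    unfolding represented_by_def by (rule rev_image_eqI)
qed

lemma M21_eq: "M21 = on_ends ` RMfin"
  by (simp add: M21_def quotient_def UNION_singleton_eq_range image_image class_on_ends cong: image_cong)

lemma finite_domC_if_finite_gen:
  assumes "ri_morphism f" "dom f = gen_ideal P" "finite P"
  shows "f \<in> RMfin"
proof -
  have "domC f \<subseteq> P"
    using domC_props[of f] assms prefix_code_subset by (metis ri_morphism_def)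
  then show ?thesis using assms finite_subset by (auto simp: RMfin_def)
qed

lemma ri_morphism_comp: "ri_morphism f \<Longrightarrow> ri_morphism g \<Longrightarrow> ri_morphism (f \<circ>\<^sub>m g)"
  by (rule ri_morphismI) (auto simp: map_comp_Some_iff ri_morphism_append)

lemma RMfin_comp:
  assumes "f \<in> RMfin" "g \<in> RMfin"
  shows "f \<circ>\<^sub>m g \<in> RMfin"
proof (rule finite_domC_if_finite_gen)
  have rf: "ri_morphism f" and rg: "ri_morphism g" and fin: "finite (domC f)" "finite (domC g)"
    using assms by (auto simp: RMfin_def)
  show r: "ri_morphism (f \<circ>\<^sub>m g)" using rf rg by (rule ri_morphism_comp)
  have df: "dom f = gen_ideal (domC f)" and dg: "dom g = gen_ideal (domC g)"
    using rf rg domC_props(2) by (auto simp: ri_morphism_def)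
  let ?X = "\<Union>x\<in>domC g. insert x ((\<lambda>u. x @ u) ` {u. the (g x) @ u \<in> domC f})"
  let ?P = "?X \<inter> dom (f \<circ>\<^sub>m g)"
  have "finite {u. the (g x) @ u \<in> domC f}" for x
    by (rule finite_vimageI[OF fin(1), of "\<lambda>u. the (g x) @ u", unfolded vimage_def]) (simp add: inj_def)
  then show "finite ?P" using fin(2) by auto
  have "w \<in> gen_ideal ?P" if "w \<in> dom (f \<circ>\<^sub>m g)" for w
  proof -
    from that obtain y v where w: "g w = Some y" "f y = Some v" by (auto simp: map_comp_Some_iff)
    then have "w \<in> gen_ideal (domC g)" using dg by blast
    then obtain x u where x: "x \<in> domC g" "w = x @ u" by (auto simp: gen_ideal_def)
    then have "x \<in> gen_ideal (domC g)" by (auto simp: gen_ideal_iff)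
    with dg obtain y0 where y0: "g x = Some y0" by blast
    then have y: "y = y0 @ u" using ri_morphism_append[OF rg y0, of u] w x by simp
    have "y \<in> gen_ideal (domC f)" using w df by blast
    then obtain p s where p: "p \<in> domC f" "y = p @ s" by (auto simp: gen_ideal_def)
    then have "p \<in> gen_ideal (domC f)" by (auto simp: gen_ideal_iff)
    with df obtain q where q: "f p = Some q" by blast
    show ?thesis
    proof (cases "length p \<le> length y0")
      case True
      then obtain t where "y0 = p @ t" using y p(2)
        by (metis append_eq_append_conv_if append_take_drop_id)
      then have "x \<in> ?P" using x y0 ri_morphism_append[OF rf q] by auto
      then show ?thesis using x by (auto simp: gen_ideal_def)
    next
      case False
      then obtain t where t: "p = y0 @ t" "u = t @ s" using y p(2)
        by (metis append_eq_append_conv2 length_append le_add1)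
      have "x @ t \<in> ?X" using x(1) y0 p(1) t(1) by force
      moreover have "x @ t \<in> dom (f \<circ>\<^sub>m g)" using q t ri_morphism_append[OF rg y0, of t] by auto
      ultimately have "x @ t \<in> ?P" by blast
      then show ?thesis using x t unfolding gen_ideal_iff by (intro bexI) auto
    qed
  qed
  moreover have "gen_ideal ?P \<subseteq> gen_ideal (dom (f \<circ>\<^sub>m g))"
    unfolding gen_ideal_iff subset_iff by blast
  moreover have "gen_ideal (dom (f \<circ>\<^sub>m g)) = dom (f \<circ>\<^sub>m g)"
    using r by (simp add: ri_morphism_def right_ideal_def)
  ultimately show "dom (f \<circ>\<^sub>m g) = gen_ideal ?P" by blast
qed

lemma domC_Some: "domC Some = {[]}"
  by (rule domC_eqI) (auto simp: prefix_code_def gen_ideal_def)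

lemma Some_in_RMfin: "Some \<in> RMfin"
  by (auto simp: RMfin_def domC_Some intro: ri_morphismI)

lemma on_ends_Some: "on_ends Some = Some"
proof
  fix w :: "bool stream"
  have "ri_morphism Some" using Some_in_RMfin by (simp add: RMfin_def)
  then show "on_ends Some w = Some w" by (subst on_ends_eq_Some_iff) (auto intro: exI[of _ "[]"])
qed

lemma on_ends_comp:
  assumes f: "ri_morphism f" and g: "ri_morphism g"
  shows "on_ends (f \<circ>\<^sub>m g) = on_ends f \<circ>\<^sub>m on_ends g"
proof -
  have "on_ends (f \<circ>\<^sub>m g) w = Some v \<longleftrightarrow> (on_ends f \<circ>\<^sub>m on_ends g) w = Some v" for w v
  proof
    assume "on_ends (f \<circ>\<^sub>m g) w = Some v"
    then show "(on_ends f \<circ>\<^sub>m on_ends g) w = Some v"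
      unfolding on_ends_eq_Some_iff[OF ri_morphism_comp[OF f g]] map_comp_Some_iff
        on_ends_eq_Some_iff[OF f] on_ends_eq_Some_iff[OF g] by blast
  next
    assume "(on_ends f \<circ>\<^sub>m on_ends g) w = Some v"
    then obtain x y z p q s where x: "g x = Some y" "w = x @- z" "f p = Some q"
        "y @- z = p @- s" "v = q @- s"
      unfolding map_comp_Some_iff on_ends_eq_Some_iff[OF f] on_ends_eq_Some_iff[OF g] by blast
    define n where "n = length p"
    have gx: "g (x @ stake n z) = Some (y @ stake n z)" using ri_morphism_append[OF g x(1)] .
    have "p = take n (y @ stake n z)"
      using arg_cong[OF x(4), of "stake n"]
      by (simp add: n_def stake_shift take_stake min_def split: if_splits)
    then obtain u where u: "y @ stake n z = p @ u" by (metis append_take_drop_id)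
    have "p @- (u @- sdrop n z) = p @- s"
      using x(4) u by (metis shift_append stake_sdrop)
    then have "s = u @- sdrop n z" by simp
    moreover have "(f \<circ>\<^sub>m g) (x @ stake n z) = Some (q @ u)"
      using gx u ri_morphism_append[OF f x(3), of u] by simp
    ultimately show "on_ends (f \<circ>\<^sub>m g) w = Some v"
      unfolding on_ends_eq_Some_iff[OF ri_morphism_comp[OF f g]] using x(2,5)
      by (metis shift_append stake_sdrop)
  qed
  then show ?thesis by (intro ext) (metis not_Some_eq)
qed

lemma fin_equiv_congruence:
  assumes "(f, f') \<in> fin_equiv" "(g, g') \<in> fin_equiv"
  shows "(f \<circ>\<^sub>m g, f' \<circ>\<^sub>m g') \<in> fin_equiv"
proof -
  have m: "f \<in> RMfin" "f' \<in> RMfin" "g \<in> RMfin" "g' \<in> RMfin"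
    using assms by (auto simp: fin_equiv_def)
  then have "ri_morphism f" "ri_morphism f'" "ri_morphism g" "ri_morphism g'"
    by (auto simp: RMfin_def)
  with m assms show ?thesis
    by (simp add: fin_equiv_iff_on_ends RMfin_comp on_ends_comp)
qed

lemma M21_quotient_mult:
  assumes "f \<in> RMfin" "g \<in> RMfin"
  shows "fin_equiv `` {f} \<otimes>\<^bsub>M21_quotient\<^esub> fin_equiv `` {g} = fin_equiv `` {f \<circ>\<^sub>m g}"
proof -
  have "fin_equiv `` {f' \<circ>\<^sub>m g'} = fin_equiv `` {f \<circ>\<^sub>m g}"
    if "(f, f') \<in> fin_equiv" "(g, g') \<in> fin_equiv" for f' g'
    using fin_equiv_congruence[OF that] equiv_class_eq[OF equiv_fin_equiv] by metis
  moreover have "(f, f) \<in> fin_equiv" "(g, g) \<in> fin_equiv"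
    using assms by (auto simp: fin_equiv_def)
  ultimately have "(\<Union>f'\<in>fin_equiv `` {f}. \<Union>g'\<in>fin_equiv `` {g}. fin_equiv `` {f' \<circ>\<^sub>m g'}) =
      fin_equiv `` {f \<circ>\<^sub>m g}"
    by blast
  then show ?thesis by (simp add: M21_quotient_def)
qed

text \<open>Hence the quotient monoid and \<^const>\<open>M21\<close> under composition are the same monoid.\<close>

lemma monoid_iso_class_on_ends:
  "class_on_ends \<in> iso M21_quotient (comp_monoid M21 Some)"
  "class_on_ends \<one>\<^bsub>M21_quotient\<^esub> = Some"
proof -
  have c: "carrier M21_quotient = {fin_equiv `` {f} | f. f \<in> RMfin}"
    by (auto simp: M21_quotient_def quotient_def)
  have "inj_on class_on_ends (carrier M21_quotient)"
  proof (rule inj_onI)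
    fix A B assume "A \<in> carrier M21_quotient" "B \<in> carrier M21_quotient"
      and eq: "class_on_ends A = class_on_ends B"
    then obtain f g where fg: "f \<in> RMfin" "g \<in> RMfin" "A = fin_equiv `` {f}" "B = fin_equiv `` {g}"
      by (auto simp: c)
    with eq have "(f, g) \<in> fin_equiv" by (simp add: class_on_ends fin_equiv_iff_on_ends)
    with fg show "A = B" using equiv_class_eq[OF equiv_fin_equiv] by metis
  qed
  then have "bij_betw class_on_ends (carrier M21_quotient) M21"
    by (simp add: bij_betw_def M21_def M21_quotient_def)
  moreover have "class_on_ends (A \<otimes>\<^bsub>M21_quotient\<^esub> B) = class_on_ends A \<circ>\<^sub>m class_on_ends B"
    if "A \<in> carrier M21_quotient" "B \<in> carrier M21_quotient" for A B
  proof -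
    from that obtain f g where fg: "f \<in> RMfin" "g \<in> RMfin" "A = fin_equiv `` {f}" "B = fin_equiv `` {g}"
      by (auto simp: c)
    moreover from fg have "ri_morphism f" "ri_morphism g" by (auto simp: RMfin_def)
    ultimately show ?thesis by (simp add: M21_quotient_mult class_on_ends RMfin_comp on_ends_comp)
  qed
  ultimately show "class_on_ends \<in> iso M21_quotient (comp_monoid M21 Some)"
    by (auto simp: iso_def hom_def comp_monoid_def bij_betw_def)
  show "class_on_ends \<one>\<^bsub>M21_quotient\<^esub> = Some"
    by (simp add: M21_quotient_def class_on_ends Some_in_RMfin on_ends_Some)
qed

section \<open>Injectivity on finite words\<close>

text \<open>On finite words \<open>\<iota> \<circ> \<rho>\<close> does not see which part of \<open>{\<epsilon>} \<union> 0{0,1}\<^sup>*\<close> lies in the domain of a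
  member of \<open>F\<^sub>0\<close>: the identity and its restriction to the nonempty words are different members of
  \<^const>\<open>F0_RM\<close> with the same total image.  On \<open>RM\<^sup>f\<^sup>i\<^sup>n\<close>, injectivity can therefore only hold
  modulo the choice of this part of the domain.\<close>

lemma maximal_prefix_code_length1: "maximal_prefix_code {[False], [True]}"
  unfolding maximal_prefix_code_def
proof (intro conjI allI impI)
  show "prefix_code {[False], [True]}" by (auto simp: prefix_code_def strict_prefix_def)
  fix Q assume Q: "prefix_code Q \<and> {[False], [True]} \<subseteq> Q"
  have "x \<in> {[False], [True]}" if x: "x \<in> Q" for x
  proof (cases x)
    case Nil
    then have "strict_prefix x [True]" by (simp add: strict_prefix_def)
    with Q x show ?thesis by (auto simp: prefix_code_def)
  next
    case (Cons b u)
    have "[b] \<in> Q" using Q by (cases b) auto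
    then have "\<not> strict_prefix [b] x" using Q x by (auto simp: prefix_code_def)
    with Cons show ?thesis by (cases b) (auto simp: strict_prefix_def)
  qed
  then have "Q \<subseteq> {[False], [True]}" by (rule subsetI)
  moreover have "{[False], [True]} \<subseteq> Q" using Q by (rule conjunct2)
  ultimately show "Q = {[False], [True]}" by (rule subset_antisym)
qed

lemma iota_rho_not_inj_on_RM:
  defines "id' \<equiv> (\<lambda>x. if x = [] then None else Some x)"
  shows "Some \<in> F0_RM" "id' \<in> F0_RM" "Some \<noteq> id'"
    "(iotaF \<circ> rhoF) Some = (iotaF \<circ> rhoF) id'"
    "(iotaF \<circ> rhoF) Some \<in> totRMfin"
proof -
  have "Q = {[]}" if Q: "prefix_code Q" "[] \<in> Q" for Q
  proof -
    have "x = []" if "x \<in> Q" for x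
      using Q that unfolding prefix_code_def strict_prefix_def by (metis Nil_prefix)
    with Q show ?thesis by blast
  qed
  moreover have "prefix_code {[]}" by (simp add: prefix_code_def)
  ultimately have "maximal_prefix_code {[]}" unfolding maximal_prefix_code_def by blast
  then have t: "Some \<in> totRMfin"
    using Some_in_RMfin by (simp add: totRMfin_def domC_Some)
  then show "Some \<in> F0_RM" by (simp add: F0_RM_def)
  have id'_simps: "id' [] = None" "id' (b # u) = Some (b # u)" for b u
    by (simp_all add: id'_def)
  have dom: "dom id' = gen_ideal {[False], [True]}"
  proof (rule Set.set_eqI)
    fix x show "x \<in> dom id' \<longleftrightarrow> x \<in> gen_ideal {[False], [True]}"
      by (cases x) (auto simp: gen_ideal_iff id'_simps)
  qed
  have "domC id' = {[False], [True]}"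
    using maximal_prefix_code_length1 dom by (intro domC_eqI) (auto simp: maximal_prefix_code_def)
  moreover have "ri_morphism id'"
  proof (rule ri_morphismI)
    fix x y u assume "id' x = Some y"
    then show "id' (x @ u) = Some (y @ u)" by (cases x) (auto simp: id'_simps)
  qed
  ultimately show "id' \<in> F0_RM"
    using maximal_prefix_code_length1 by (simp add: F0_RM_def totRMfin_def RMfin_def id'_simps)
  show "Some \<noteq> id'" using id'_simps(1) by (metis option.distinct(1))
  have i: "inj ((#) True)" by (simp add: inj_def)
  have "iotaF (rhoF h) z = Some z" if "h (True # z) = Some (True # z)" for h z
    unfolding iota_eq_Some_iff[OF i] using that by (simp add: rho_def graph_restrict_def)
  then have "iotaF (rhoF Some) = Some" "iotaF (rhoF id') = Some"
    using id'_simps by blast+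
  with t show "(iotaF \<circ> rhoF) Some = (iotaF \<circ> rhoF) id'"
    "(iotaF \<circ> rhoF) Some \<in> totRMfin" by simp_all
qed

end

theory Submission
  imports Defs
begin

text \<open>
  The idea is to complete a partial function to a total one with the help of an extra region of
  the word space: the words that start with 1 carry a copy of the given function \<open>g\<close>, and the long
  words \<open>1z\<close> with \<open>g(z)\<close> undefined are sent into the region \<open>0{0,1}\<^sup>*\<close>, which plays the role of a sink.
  Since the members of \<open>F\<^sub>0\<close> and \<open>S\<^sub>0\<close> never lead out of the sink, the part \<open>1\<dots> \<mapsto> 1\<dots>\<close> of a
  composition is the composition of the parts \<open>1\<dots> \<mapsto> 1\<dots>\<close>.  This is what makes \<open>\<rho>\<close>
  multiplicative (\<open>reflects\<close> and \<open>rho_comp\<close>), and the lemma \<open>corner_epi\<close> turns it into all the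
  statements on epimorphisms and isomorphisms, provided that the image of \<open>\<iota> \<circ> \<rho>\<close> is known.

  On finite words the image is computed by hand.  Domain codes are replaced by equivalent
  conditions on domains: a domain code is finite iff from some length on the domain is determined by
  prefixes of that length, and it is moreover maximal iff the domain contains all sufficiently long
  words.  A preimage under \<open>\<iota> \<circ> \<rho>\<close> is then the explicit completion \<open>sink_completion\<close>.

  The statements on infinite words follow from those on finite words.  The action on ends commutes
  with \<open>\<rho>\<close> and \<open>\<iota>\<close>, and all monoids involved are images of the corresponding monoids of morphisms;
  for the length equality preserving ones this uses that deleting the short words from the
  domain makes the domain code a set of words of one length without changing the action on ends.
\<close>

section \<open>Corners of monoids of partial functions\<close>

lemma map_eqI:
  assumes "\<And>x y. f x = Some y \<longleftrightarrow> g x = Some y"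
  shows "f = g"
  using assms by (intro ext) (metis not_Some_eq)

definition comp_closed :: "('a \<rightharpoonup> 'a) set \<Rightarrow> bool" where
  "comp_closed A \<longleftrightarrow> Some \<in> A \<and> (\<forall>f\<in>A. \<forall>g\<in>A. f \<circ>\<^sub>m g \<in> A)"

lemma map_comp_assoc: "(f \<circ>\<^sub>m g) \<circ>\<^sub>m h = f \<circ>\<^sub>m (g \<circ>\<^sub>m h)"
  by (rule map_eqI) (auto simp: map_comp_Some_iff)

lemma map_comp_Some_right: "f \<circ>\<^sub>m Some = f"
  by (rule map_eqI) (auto simp: map_comp_Some_iff)

lemma map_comp_Some_left: "Some \<circ>\<^sub>m f = f"
  by (rule map_eqI) (auto simp: map_comp_Some_iff)

lemma comp_closed_monoid: "comp_closed A \<Longrightarrow> monoid (comp_monoid A Some)"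
  by (intro monoidI)
    (auto simp: comp_closed_def comp_monoid_def map_comp_assoc map_comp_Some_right map_comp_Some_left)

lemma comp_closed_submonoid:
  "comp_closed A \<Longrightarrow> A \<subseteq> B \<Longrightarrow> submonoid A (comp_monoid B Some)"
  by unfold_locales (auto simp: comp_closed_def comp_monoid_def)

text \<open>A homomorphism of multiplicative structures transports the monoid laws to its image; in this
  way the corner \<open>\<rho>(A)\<close>, with its own identity, is seen to be a monoid.\<close>

lemma monoid_hom_image:
  assumes "monoid G" "h \<in> epi G H" "h \<one>\<^bsub>G\<^esub> = \<one>\<^bsub>H\<^esub>"
  shows "monoid H"
proof -
  interpret G: monoid G by fact
  have im: "h ` carrier G = carrier H"
    and mult: "\<And>x y. x \<in> carrier G \<Longrightarrow> y \<in> carrier G \<Longrightarrow> h x \<otimes>\<^bsub>H\<^esub> h y = h (x \<otimes>\<^bsub>G\<^esub> y)"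
    using assms(2) by (auto simp: epi_def hom_def)
  show ?thesis
  proof (rule monoidI)
    show "\<one>\<^bsub>H\<^esub> \<in> carrier H"
      unfolding im[symmetric] assms(3)[symmetric] by blast
  next
    fix x y assume "x \<in> carrier H" "y \<in> carrier H"
    then show "x \<otimes>\<^bsub>H\<^esub> y \<in> carrier H"
      unfolding im[symmetric] by (auto simp: mult)
  next
    fix x y z assume "x \<in> carrier H" "y \<in> carrier H" "z \<in> carrier H"
    then show "x \<otimes>\<^bsub>H\<^esub> y \<otimes>\<^bsub>H\<^esub> z = x \<otimes>\<^bsub>H\<^esub> (y \<otimes>\<^bsub>H\<^esub> z)"
      unfolding im[symmetric] by (auto simp: mult G.m_assoc)
  next
    fix x assume "x \<in> carrier H"
    then show "\<one>\<^bsub>H\<^esub> \<otimes>\<^bsub>H\<^esub> x = x" "x \<otimes>\<^bsub>H\<^esub> \<one>\<^bsub>H\<^esub> = x"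
      unfolding im[symmetric] assms(3)[symmetric] by (auto simp: mult)
  qed
qed

lemma rho_eq_Some_iff: "rho c f x = Some y \<longleftrightarrow> x \<in> range c \<and> y \<in> range c \<and> f x = Some y"
  by (auto simp: rho_def graph_restrict_def)

lemma iota_rho:
  assumes "inj c"
  shows "iota c (rho c f) = iota c f"
  by (rule map_eqI) (simp add: iota_eq_Some_iff[OF assms] rho_eq_Some_iff)

text \<open>With \<open>c\<close> prefixing the letter 1, this is the weak form of invariance of the sink that
  multiplicativity of \<open>\<rho>\<close> needs; on finite words it also covers the empty word.\<close>

definition reflects :: "('a \<Rightarrow> 'a) \<Rightarrow> ('a \<rightharpoonup> 'a) \<Rightarrow> bool" where
  "reflects c f \<longleftrightarrow> (\<forall>x y. f x = Some (c y) \<longrightarrow> x \<in> range c)"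

text \<open>If \<open>f(g(x))\<close> lies in the range of \<open>c\<close>, then so does the intermediate value \<open>g(x)\<close>; hence no
  argument is lost when \<open>f\<close> and \<open>g\<close> are restricted separately.\<close>

lemma rho_comp: "reflects c f \<Longrightarrow> rho c (f \<circ>\<^sub>m g) = rho c f \<circ>\<^sub>m rho c g"
  by (rule map_eqI) (auto simp: map_comp_Some_iff rho_eq_Some_iff reflects_def)

lemma reflects_rho: "reflects c (rho c f)"
  by (auto simp: reflects_def rho_eq_Some_iff)

lemma iota_comp:
  assumes "inj c" "reflects c f"
  shows "iota c (f \<circ>\<^sub>m g) = iota c f \<circ>\<^sub>m iota c g"
proof (rule map_eqI)
  fix z y
  have "(\<exists>w. g (c z) = Some w \<and> f w = Some (c y)) \<longleftrightarrow>
      (\<exists>w. g (c z) = Some (c w) \<and> f (c w) = Some (c y))"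
    using assms(2) unfolding reflects_def by blast
  then show "iota c (f \<circ>\<^sub>m g) z = Some y \<longleftrightarrow> (iota c f \<circ>\<^sub>m iota c g) z = Some y"
    by (simp add: map_comp_Some_iff iota_eq_Some_iff[OF assms(1)])
qed

lemma iota_inj_on_rho:
  assumes c: "inj c" and eq: "iota c (rho c f) = iota c (rho c g)"
  shows "rho c f = rho c g"
proof (rule map_eqI)
  have "f (c z) = Some (c w) \<longleftrightarrow> g (c z) = Some (c w)" for z w
    using iota_eq_Some_iff[OF c] eq iota_rho[OF c] by metis
  then show "rho c f x = Some y \<longleftrightarrow> rho c g x = Some y" for x y
    by (auto simp: rho_eq_Some_iff)
qed

lemma iota_Some: "inj c \<Longrightarrow> iota c Some = Some"
  by (rule map_eqI) (auto simp: iota_eq_Some_iff inj_def)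

text \<open>Since \<open>\<iota>\<close> is injective on the image of \<open>\<rho>\<close> and every member of that image reflects the range of
  \<open>c\<close>, all that remains to be found in each case is the set \<open>B\<close>.  It is closed under composition
  because it is a homomorphic image.\<close>

lemma corner_epi:
  assumes c: "inj c" and A: "comp_closed A" and refl: "\<And>f. f \<in> A \<Longrightarrow> reflects c f"
    and B: "iota c ` A = B"
  shows "monoid_epi (comp_monoid A Some) (comp_monoid (rho c ` A) (rho c Some)) (rho c) \<and>
    monoid_iso (comp_monoid (rho c ` A) (rho c Some)) (comp_monoid B Some) (iota c) \<and>
    monoid_epi (comp_monoid A Some) (comp_monoid B Some) (iota c \<circ> rho c)"
proof -
  let ?A = "comp_monoid A Some" and ?R = "comp_monoid (rho c ` A) (rho c Some)"
    and ?B = "comp_monoid B Some"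
  have mA: "monoid ?A" using A by (rule comp_closed_monoid)
  have e: "rho c \<in> epi ?A ?R"
    using refl by (auto simp: epi_def hom_def comp_monoid_def rho_comp)
  have mR: "monoid ?R" by (rule monoid_hom_image[OF mA e]) (simp add: comp_monoid_def)
  have im: "(iota c \<circ> rho c) ` A = B" using B by (simp add: iota_rho[OF c] image_def)
  have "inj_on (iota c) (rho c ` A)"
    using iota_inj_on_rho[OF c] by (auto intro!: inj_onI)
  moreover have "iota c ` rho c ` A = B" using im by (simp add: image_comp)
  ultimately have i: "iota c \<in> iso ?R ?B"
    using iota_comp[OF c reflects_rho]
    by (auto simp: iso_def hom_def comp_monoid_def bij_betw_def)
  have one: "iota c (rho c Some) = Some" by (simp add: iota_rho[OF c] iota_Some[OF c])
  have iepi: "iota c \<in> epi ?R ?B" using i by (auto simp: iso_def epi_def bij_betw_def)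
  have mB: "monoid ?B" by (rule monoid_hom_image[OF mR iepi]) (simp add: comp_monoid_def one)
  have "iota c \<circ> rho c \<in> epi ?A ?B"
    unfolding epi_def using e iepi im by (auto simp: epi_def comp_monoid_def hom_def)
  then show ?thesis
    using mA mR mB e i one by (simp add: monoid_epi_def monoid_iso_def) (simp add: comp_monoid_def one)
qed

section \<open>Domain codes and lengths\<close>

lemma ri_morphism_long:
  assumes "ri_morphism f" "f (take n x) = Some y"
  shows "f x = Some (y @ drop n x)"
  using ri_morphism_append[OF assms, of "drop n x"] by simp

lemma dom_append: "ri_morphism f \<Longrightarrow> x \<in> dom f \<Longrightarrow> x @ u \<in> dom f"
  using ri_morphism_append by blast

lemma dom_gen_ideal_domC:
  assumes "ri_morphism f"
  shows "x \<in> dom f \<longleftrightarrow> (\<exists>p\<in>domC f. prefix p x)"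
  using domC_props(2)[of f] assms by (simp add: ri_morphism_def gen_ideal_iff)

lemma domC_subset_dom: "ri_morphism f \<Longrightarrow> p \<in> domC f \<Longrightarrow> p \<in> dom f"
  using dom_gen_ideal_domC by blast

lemma domC_no_strict_prefix:
  assumes f: "ri_morphism f" and "p \<in> domC f" "x \<in> dom f" "prefix x p"
  shows "x = p"
proof -
  obtain q where q: "q \<in> domC f" "prefix q x" using assms dom_gen_ideal_domC by blast
  then have "q = p"
    using domC_props(1)[of f] assms unfolding ri_morphism_def prefix_code_def strict_prefix_def
    by (meson prefix_order.order_trans)
  with q assms(4) show ?thesis using prefix_order.antisym by blast
qed

lemma domC_length_le:
  assumes f: "ri_morphism f" and p: "p \<in> domC f" and x: "take N p \<in> dom f"
  shows "length p \<le> N"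
  using domC_no_strict_prefix[OF f p x take_is_prefix] by (metis length_take min.cobounded2)

lemma take_in_dom_of_long:
  assumes f: "ri_morphism f" and "\<forall>p\<in>domC f. length p \<le> N" "x \<in> dom f" "N \<le> length x"
  shows "take N x \<in> dom f"
proof -
  obtain p where p: "p \<in> domC f" "prefix p x" using assms dom_gen_ideal_domC by blast
  then have "prefix p (take N x)" using assms(2,4) by (auto simp: prefix_def)
  with p show ?thesis using dom_gen_ideal_domC[OF f] by blast
qed

lemma finite_words_le: "finite {x :: bool list. length x \<le> N}"
  using finite_lists_length_le[of "UNIV :: bool set" N] by simp

lemma RMfin_iff:
  "f \<in> RMfin \<longleftrightarrow> ri_morphism f \<and> (\<exists>N. \<forall>x\<in>dom f. N \<le> length x \<longrightarrow> take N x \<in> dom f)"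
proof (intro iffI conjI)
  assume "f \<in> RMfin"
  then have f: "ri_morphism f" and "finite (domC f)" by (auto simp: RMfin_def)
  then obtain N where "\<forall>p\<in>domC f. length p \<le> N"
    by (metis finite_imageI finite_nat_set_iff_bounded_le imageI)
  with f show "\<exists>N. \<forall>x\<in>dom f. N \<le> length x \<longrightarrow> take N x \<in> dom f"
    using take_in_dom_of_long by blast
  show "ri_morphism f" by fact
next
  assume "ri_morphism f \<and> (\<exists>N. \<forall>x\<in>dom f. N \<le> length x \<longrightarrow> take N x \<in> dom f)"
  then obtain N where f: "ri_morphism f"
    and N: "\<And>x. x \<in> dom f \<Longrightarrow> N \<le> length x \<Longrightarrow> take N x \<in> dom f" by blast
  have "length p \<le> N" if "p \<in> domC f" for p
    using domC_length_le[OF f that N] domC_subset_dom[OF f that] nat_le_linear by blast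
  then have "finite (domC f)" using finite_subset[OF _ finite_words_le] by blast
  with f show "f \<in> RMfin" by (simp add: RMfin_def)
qed

text \<open>A word that has no prefix in a finite code, and is at least as long as all its words, can be
  added to the code.  So maximality of the code means that there are no such words.\<close>

lemma totRMfin_iff:
  "f \<in> totRMfin \<longleftrightarrow> ri_morphism f \<and> (\<exists>N. \<forall>x. N \<le> length x \<longrightarrow> x \<in> dom f)"
proof (intro iffI conjI)
  assume "f \<in> totRMfin"
  then have f: "ri_morphism f" and "finite (domC f)" and max: "maximal_prefix_code (domC f)"
    by (auto simp: totRMfin_def RMfin_def)
  then obtain N where N: "\<And>p. p \<in> domC f \<Longrightarrow> length p \<le> N"
    by (metis finite_imageI finite_nat_set_iff_bounded_le imageI)
  have "x \<in> dom f" if "N \<le> length x" for x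
  proof (rule ccontr)
    assume x: "x \<notin> dom f"
    then have "\<not> strict_prefix p x" if "p \<in> domC f" for p
      using dom_gen_ideal_domC[OF f] that by (auto simp: strict_prefix_def)
    moreover have "\<not> strict_prefix x p" if "p \<in> domC f" for p
      using N[OF that] \<open>N \<le> length x\<close> prefix_length_less by fastforce
    ultimately have "prefix_code (insert x (domC f))"
      using max by (auto simp: maximal_prefix_code_def prefix_code_def)
    then have "x \<in> domC f" using max unfolding maximal_prefix_code_def by blast
    with x domC_subset_dom[OF f] show False by blast
  qed
  then show "\<exists>N. \<forall>x. N \<le> length x \<longrightarrow> x \<in> dom f" by blast
  show "ri_morphism f" by fact
next
  assume "ri_morphism f \<and> (\<exists>N. \<forall>x. N \<le> length x \<longrightarrow> x \<in> dom f)"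
  then obtain N where f: "ri_morphism f" and N: "\<And>x. N \<le> length x \<Longrightarrow> x \<in> dom f" by blast
  have "f \<in> RMfin" unfolding RMfin_iff using f N by (intro conjI exI[of _ N]) auto
  moreover have "Q \<subseteq> domC f" if Q: "prefix_code Q" "domC f \<subseteq> Q" for Q
  proof
    fix q assume q: "q \<in> Q"
    have "q @ replicate N False \<in> dom f" by (rule N) simp
    then obtain p where p: "p \<in> domC f" "prefix p (q @ replicate N False)"
      using dom_gen_ideal_domC[OF f] by blast
    then have "prefix p q \<or> prefix q p" by (metis prefixI prefix_same_cases)
    with Q p(1) q have "p = q" unfolding prefix_code_def strict_prefix_def by blast
    with p show "q \<in> domC f" by simp
  qed
  then have "maximal_prefix_code (domC f)"
    using domC_props(1)[of f] f by (auto simp: maximal_prefix_code_def ri_morphism_def)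
  ultimately show "f \<in> totRMfin" by (simp add: totRMfin_def)
qed

lemma pflRMfin_iff:
  "f \<in> pflRMfin \<longleftrightarrow> ri_morphism f \<and> plep f \<and> (\<exists>m. \<forall>x\<in>dom f. m \<le> length x \<and> take m x \<in> dom f)"
proof
  assume "f \<in> pflRMfin"
  then obtain m where f: "ri_morphism f" "plep f" and m: "\<forall>p\<in>domC f. length p = m"
    unfolding pflRMfin_def plepRMfin_def RMfin_def by blast
  have "m \<le> length x \<and> take m x \<in> dom f" if "x \<in> dom f" for x
    using that m dom_gen_ideal_domC[OF f(1)] prefix_length_le take_in_dom_of_long[OF f(1), of m x]
    by (metis order_refl)
  with f show "ri_morphism f \<and> plep f \<and> (\<exists>m. \<forall>x\<in>dom f. m \<le> length x \<and> take m x \<in> dom f)" by blast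
next
  assume "ri_morphism f \<and> plep f \<and> (\<exists>m. \<forall>x\<in>dom f. m \<le> length x \<and> take m x \<in> dom f)"
  then obtain m where f: "ri_morphism f" "plep f"
    and m: "\<And>x. x \<in> dom f \<Longrightarrow> m \<le> length x \<and> take m x \<in> dom f" by blast
  have "f \<in> RMfin" unfolding RMfin_iff using f m by blast
  moreover have "length p = m" if "p \<in> domC f" for p
    using domC_length_le[OF f(1) that] m domC_subset_dom[OF f(1) that] by (meson le_antisym)
  ultimately show "f \<in> pflRMfin" using f by (auto simp: pflRMfin_def plepRMfin_def)
qed

lemma tflRMfin_iff:
  "f \<in> tflRMfin \<longleftrightarrow> ri_morphism f \<and> plep f \<and> (\<exists>m. dom f = {x. m \<le> length x})"
proof
  assume "f \<in> tflRMfin"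
  then obtain m where f: "ri_morphism f" "plep f" and m: "domC f = {x. length x = m}"
    by (auto simp: tflRMfin_def tlepRMfin_def totRMfin_def RMfin_def)
  have "x \<in> dom f \<longleftrightarrow> m \<le> length x" for x
  proof
    assume "m \<le> length x"
    then show "x \<in> dom f" unfolding dom_gen_ideal_domC[OF f(1)] m
      by (intro bexI[of _ "take m x"]) (auto simp: take_is_prefix)
  qed (use dom_gen_ideal_domC[OF f(1)] m prefix_length_le in auto)
  with f show "ri_morphism f \<and> plep f \<and> (\<exists>m. dom f = {x. m \<le> length x})" by blast
next
  assume "ri_morphism f \<and> plep f \<and> (\<exists>m. dom f = {x. m \<le> length x})"
  then obtain m where f: "ri_morphism f" "plep f" and m: "dom f = {x. m \<le> length x}" by blast
  have "f \<in> totRMfin" unfolding totRMfin_iff using f m by blast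
  moreover have "domC f = {x. length x = m}"
  proof (rule domC_eqI)
    show "prefix_code {x. length x = m}"
      by (auto simp: prefix_code_def dest: prefix_length_less)
    have "m \<le> length x \<longleftrightarrow> (\<exists>p. length p = m \<and> prefix p x)" for x :: "bool list"
      by (metis length_take min.absorb2 prefix_length_le take_is_prefix)
    then show "dom f = gen_ideal {x. length x = m}" by (auto simp: m gen_ideal_iff)
  qed
  ultimately show "f \<in> tflRMfin" using f by (auto simp: tflRMfin_def tlepRMfin_def)
qed

lemma plepD:
  "plep f \<Longrightarrow> f x = Some y \<Longrightarrow> f x' = Some y' \<Longrightarrow> length x = length x' \<Longrightarrow> length y = length y'"
  unfolding plep_def by (metis domI option.sel)

lemma plepI:
  assumes "\<And>x x' y y'. f x = Some y \<Longrightarrow> f x' = Some y' \<Longrightarrow> length x = length x' \<Longrightarrow> length y = length y'"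
  shows "plep f"
  unfolding plep_def using assms by (metis domD option.sel)

section \<open>Closure under composition\<close>

lemma plep_comp:
  assumes "plep f" "plep g" shows "plep (f \<circ>\<^sub>m g)"
proof (rule plepI)
  fix x x' z z' assume "(f \<circ>\<^sub>m g) x = Some z" "(f \<circ>\<^sub>m g) x' = Some z'" and l: "length x = length x'"
  then obtain y y' where y: "g x = Some y" "g x' = Some y'" and z: "f y = Some z" "f y' = Some z'"
    unfolding map_comp_Some_iff by blast
  show "length z = length z'" by (rule plepD[OF assms(1) z plepD[OF assms(2) y l]])
qed

lemma plep_Some: "plep Some"
  by (auto simp: plep_def)

lemma ri_morphism_Some: "ri_morphism Some"
  by (auto intro: ri_morphismI)

lemma totRMfin_closed: "comp_closed totRMfin"
  unfolding comp_closed_def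
proof (intro conjI ballI)
  show "Some \<in> totRMfin" by (auto simp: totRMfin_iff ri_morphism_Some)
  fix f g assume "f \<in> totRMfin" "g \<in> totRMfin"
  then obtain N M where f: "ri_morphism f" and N: "\<And>x. N \<le> length x \<Longrightarrow> x \<in> dom f"
    and g: "ri_morphism g" and M: "\<And>x. M \<le> length x \<Longrightarrow> x \<in> dom g"
    unfolding totRMfin_iff by blast
  have "x \<in> dom (f \<circ>\<^sub>m g)" if x: "N + M \<le> length x" for x
  proof -
    have "take M x \<in> dom g" using x by (intro M) simp
    then obtain y where y: "g (take M x) = Some y" by blast
    have "y @ drop M x \<in> dom f" using x by (intro N) simp
    with ri_morphism_long[OF g y] show ?thesis by (auto simp: map_comp_Some_iff)
  qed
  with ri_morphism_comp[OF f g] show "f \<circ>\<^sub>m g \<in> totRMfin" unfolding totRMfin_iff by blast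
qed

text \<open>A length equality preserving \<open>g\<close> with domain \<open>{x. m \<le> |x|}\<close> changes all lengths by the same
  amount, so that the preimage of \<open>{y. N \<le> |y|}\<close> has again this form.\<close>

lemma tflRMfin_closed: "comp_closed tflRMfin"
  unfolding comp_closed_def
proof (intro conjI ballI)
  have "dom (Some :: bool list \<rightharpoonup> bool list) = {x. 0 \<le> length x}" by auto
  then show "Some \<in> tflRMfin" unfolding tflRMfin_iff using ri_morphism_Some plep_Some by blast
  fix f g assume fg: "f \<in> tflRMfin" "g \<in> tflRMfin"
  then obtain N M where f: "ri_morphism f" "plep f" and N: "dom f = {x. N \<le> length x}"
    and g: "ri_morphism g" "plep g" and M: "dom g = {x. M \<le> length x}"
    unfolding tflRMfin_iff by blast
  have "replicate M False \<in> dom g" by (simp add: M)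
  then obtain y0 where y0: "g (replicate M False) = Some y0" by blast
  have "x \<in> dom (f \<circ>\<^sub>m g) \<longleftrightarrow> M + (N - length y0) \<le> length x" for x
  proof (cases "M \<le> length x")
    case True
    then have "take M x \<in> dom g" by (simp add: M)
    then obtain y where y: "g (take M x) = Some y" by blast
    have l: "length y = length y0" using plepD[OF g(2) y y0] True by simp
    have "x \<in> dom (f \<circ>\<^sub>m g) \<longleftrightarrow> y @ drop M x \<in> dom f"
      using ri_morphism_long[OF g(1) y] by (auto simp: dom_def map_comp_Some_iff)
    with True l show ?thesis by (auto simp: N)
  next
    case False
    then have "x \<notin> dom g" by (simp add: M)
    then have "x \<notin> dom (f \<circ>\<^sub>m g)" by (auto simp: dom_def map_comp_Some_iff)
    with False show ?thesis by simp
  qed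
  then show "f \<circ>\<^sub>m g \<in> tflRMfin"
    unfolding tflRMfin_iff using ri_morphism_comp[OF f(1) g(1)] plep_comp[OF f(2) g(2)] by blast
qed

lemma F0_RM_value:
  assumes "f \<in> F0_RM" "f (False # z) = Some y"
  shows "y = False # z"
proof -
  have "f (False # z) = Some (False # z)" using assms unfolding F0_RM_def by blast
  with assms(2) show ?thesis by simp
qed

lemma S0_RM_value:
  assumes "f \<in> S0_RM" "f (False # z) = Some y"
  shows "\<exists>y'. y = False # y'"
proof -
  have "\<exists>y'. f (False # z) = Some (False # y')" using assms unfolding S0_RM_def by blast
  with assms(2) show ?thesis by simp
qed

lemma F0_RM_closed: "comp_closed F0_RM"
  unfolding comp_closed_def
proof (intro conjI ballI)
  have "Some \<in> totRMfin" using totRMfin_closed unfolding comp_closed_def by (rule conjunct1)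
  then show "Some \<in> F0_RM" unfolding F0_RM_def by simp
  fix f g assume fg: "f \<in> F0_RM" "g \<in> F0_RM"
  have "(f \<circ>\<^sub>m g) (False # z) = Some (False # z)" if z: "False # z \<in> dom (f \<circ>\<^sub>m g)" for z
  proof -
    from z obtain v where "(f \<circ>\<^sub>m g) (False # z) = Some v" by blast
    then obtain y where yv: "g (False # z) = Some y" "f y = Some v"
      unfolding map_comp_Some_iff by blast
    from fg(2) yv(1) have y: "y = False # z" by (rule F0_RM_value)
    with fg(1) yv(2) have "v = False # z" using F0_RM_value by blast
    with yv y show ?thesis by simp
  qed
  moreover have "f \<circ>\<^sub>m g \<in> totRMfin"
    using fg totRMfin_closed unfolding F0_RM_def comp_closed_def by blast
  ultimately show "f \<circ>\<^sub>m g \<in> F0_RM" unfolding F0_RM_def by blast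
qed

lemma S0_RM_closed: "comp_closed S0_RM"
  unfolding comp_closed_def
proof (intro conjI ballI)
  have "Some \<in> tflRMfin" using tflRMfin_closed unfolding comp_closed_def by (rule conjunct1)
  then show "Some \<in> S0_RM" unfolding S0_RM_def by simp
  fix f g assume fg: "f \<in> S0_RM" "g \<in> S0_RM"
  have "\<exists>y. (f \<circ>\<^sub>m g) (False # z) = Some (False # y)" if z: "False # z \<in> dom (f \<circ>\<^sub>m g)" for z
  proof -
    from z obtain v where "(f \<circ>\<^sub>m g) (False # z) = Some v" by blast
    then obtain y where yv: "g (False # z) = Some y" "f y = Some v"
      unfolding map_comp_Some_iff by blast
    obtain y' where y': "y = False # y'" using S0_RM_value[OF fg(2) yv(1)] by blast
    then obtain v' where "v = False # v'" using S0_RM_value[OF fg(1)] yv(2) by blast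
    with yv show ?thesis by simp
  qed
  moreover have "f \<circ>\<^sub>m g \<in> tflRMfin"
    using fg tflRMfin_closed unfolding S0_RM_def comp_closed_def by blast
  ultimately show "f \<circ>\<^sub>m g \<in> S0_RM" unfolding S0_RM_def by blast
qed

text \<open>The empty word lies neither in \<open>0{0,1}\<^sup>*\<close> nor in \<open>1{0,1}\<^sup>*\<close>.  It cannot be mapped into
  \<open>1{0,1}\<^sup>*\<close> either, since then \<open>0\<close> would be mapped there as well.\<close>

lemma sink_invariant_reflects_words:
  assumes f: "ri_morphism f"
    and S: "\<And>z. False # z \<in> dom f \<Longrightarrow> \<exists>y. f (False # z) = Some (False # y)"
  shows "reflects ((#) True) f"
  unfolding reflects_def
proof (intro allI impI)
  fix x y assume xy: "f x = Some (True # y)"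
  show "x \<in> range ((#) True)"
  proof (cases x)
    case Nil
    then have "f [False] = Some (True # y @ [False])"
      using ri_morphism_append[OF f xy, of "[False]"] by simp
    with S[of "[]"] show ?thesis by auto
  next
    case (Cons b z)
    with xy S[of z] show ?thesis by (cases b) auto
  qed
qed

section \<open>The images of rho and iota on finite words\<close>

lemma inj_Cons: "inj ((#) True)" by simp

lemmas iotaF_iff = iota_eq_Some_iff[OF inj_Cons]

lemma ri_morphism_rhoF:
  assumes "ri_morphism f" shows "ri_morphism (rhoF f)"
proof (rule ri_morphismI)
  fix x y u assume "rhoF f x = Some y"
  then show "rhoF f (x @ u) = Some (y @ u)"
    using ri_morphism_append[OF assms, of x y u] by (auto simp: rho_eq_Some_iff)
qed

lemma ri_morphism_iotaF:
  assumes "ri_morphism f" shows "ri_morphism (iotaF f)"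
proof (rule ri_morphismI)
  fix x y u assume "iotaF f x = Some y"
  then show "iotaF f (x @ u) = Some (y @ u)"
    using ri_morphism_append[OF assms, of "True # x" "True # y" u] by (simp add: iotaF_iff)
qed

lemma plep_rhoF:
  assumes "plep f" shows "plep (rhoF f)"
proof (rule plepI)
  fix x x' y y' assume "rhoF f x = Some y" "rhoF f x' = Some y'" "length x = length x'"
  then show "length y = length y'"
    using plepD[OF assms, of x y x' y'] by (simp add: rho_eq_Some_iff)
qed

lemma plep_iotaF:
  assumes "plep f" shows "plep (iotaF f)"
proof (rule plepI)
  fix x x' y y' assume "iotaF f x = Some y" "iotaF f x' = Some y'" "length x = length x'"
  then show "length y = length y'"
    using plepD[OF assms, of "True # x" "True # y" "True # x'" "True # y'"] by (simp add: iotaF_iff)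
qed

text \<open>Whether a value starts with 1 can be read off from the value at a prefix of the argument, as
  soon as that value is not empty.\<close>

lemma value_starts_True_prefix:
  assumes "ri_morphism f" "f (x @ u) = Some (True # y)" "f x = Some v" "v \<noteq> []"
  shows "\<exists>v'. v = True # v'"
  using ri_morphism_append[OF assms(1,3), of u] assms(2,4) by (cases v) auto

text \<open>One letter beyond the length that determines the domain, all values are nonempty.\<close>

lemma RMfin_nonempty_values:
  assumes "f \<in> RMfin"
  obtains N where "\<And>x. x \<in> dom f \<Longrightarrow> N < length x \<Longrightarrow> \<exists>y. y \<noteq> [] \<and> f (take (Suc N) x) = Some y"
proof -
  from assms obtain N where f: "ri_morphism f"
    and N: "\<And>x. x \<in> dom f \<Longrightarrow> N \<le> length x \<Longrightarrow> take N x \<in> dom f"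
    unfolding RMfin_iff by blast
  have "\<exists>y. y \<noteq> [] \<and> f (take (Suc N) x) = Some y" if x: "x \<in> dom f" "N < length x" for x
  proof -
    obtain y where "f (take N x) = Some y" using N[of x] x by auto
    from ri_morphism_append[OF f this, of "[x ! N]"] x(2)
    have "f (take (Suc N) x) = Some (y @ [x ! N])" by (simp add: take_Suc_conv_app_nth)
    then show ?thesis by simp
  qed
  then show thesis by (rule that)
qed

lemma rhoF_RMfin:
  assumes fR: "f \<in> RMfin" shows "rhoF f \<in> RMfin"
proof -
  have f: "ri_morphism f" using fR by (simp add: RMfin_def)
  obtain N where N: "\<And>x. x \<in> dom f \<Longrightarrow> N < length x \<Longrightarrow> \<exists>y. y \<noteq> [] \<and> f (take (Suc N) x) = Some y"
    using RMfin_nonempty_values[OF fR] by blast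
  have "take (Suc N) x \<in> dom (rhoF f)" if x: "x \<in> dom (rhoF f)" "Suc N \<le> length x" for x
  proof -
    obtain x' y where xy: "x = True # x'" "f x = Some (True # y)"
      using x(1) by (auto simp: dom_def rho_eq_Some_iff)
    then obtain v where v: "v \<noteq> []" "f (take (Suc N) x) = Some v" using N[of x] x(2) by auto
    have "\<exists>v'. v = True # v'"
      by (rule value_starts_True_prefix[OF f _ v(2,1), of "drop (Suc N) x" y]) (simp add: xy(2))
    then have "rhoF f (take (Suc N) x) = Some v" using v(2) xy(1) by (auto simp: rho_eq_Some_iff)
    then show ?thesis by blast
  qed
  then show ?thesis unfolding RMfin_iff using ri_morphism_rhoF[OF f] by blast
qed

lemma iotaF_RMfin:
  assumes fR: "f \<in> RMfin" shows "iotaF f \<in> RMfin"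
proof -
  have f: "ri_morphism f" using fR by (simp add: RMfin_def)
  obtain N where N: "\<And>x. x \<in> dom f \<Longrightarrow> N < length x \<Longrightarrow> \<exists>y. y \<noteq> [] \<and> f (take (Suc N) x) = Some y"
    using RMfin_nonempty_values[OF fR] by blast
  have "take N z \<in> dom (iotaF f)" if z: "z \<in> dom (iotaF f)" "N \<le> length z" for z
  proof -
    obtain y where y: "f (True # z) = Some (True # y)" using z(1) by (auto simp: iotaF_iff)
    then obtain v where v: "v \<noteq> []" "f (True # take N z) = Some v"
      using N[of "True # z"] z(2) by auto
    have "\<exists>v'. v = True # v'"
      by (rule value_starts_True_prefix[OF f _ v(2,1), of "drop N z" y]) (simp add: y)
    then show ?thesis using v(2) iotaF_iff by blast
  qed
  then show ?thesis unfolding RMfin_iff using ri_morphism_iotaF[OF f] by blast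
qed

text \<open>At a given positive length, all values are as long as the value at a word \<open>0\<dots>0\<close>, which
  starts with 0.\<close>

lemma S0_RM_nonempty_values:
  assumes S: "f \<in> S0_RM" and x: "f x = Some y" "x \<noteq> []"
  shows "y \<noteq> []"
proof -
  obtain m where f: "plep f" and m: "dom f = {x. m \<le> length x}"
    using S by (auto simp: S0_RM_def tflRMfin_iff)
  define z where "z = replicate (length x - 1) False"
  have l: "length x = length (False # z)" using x(2) by (simp add: z_def)
  have "m \<le> length x" using m x(1) by blast
  then have "False # z \<in> dom f" using m l by simp
  then obtain y' where y': "f (False # z) = Some (False # y')"
    using S by (auto simp: S0_RM_def)
  show ?thesis using plepD[OF f x(1) y' l] by auto
qed

lemma rhoF_S0_RM:
  assumes S: "f \<in> S0_RM" shows "rhoF f \<in> pflRMfin"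
proof -
  obtain m where f: "ri_morphism f" "plep f" and m: "dom f = {x. m \<le> length x}"
    using S by (auto simp: S0_RM_def tflRMfin_iff)
  let ?m = "max m 1"
  have "?m \<le> length x \<and> take ?m x \<in> dom (rhoF f)" if x: "x \<in> dom (rhoF f)" for x
  proof -
    obtain x' y where xy: "x = True # x'" "f x = Some (True # y)"
      using x by (auto simp: dom_def rho_eq_Some_iff)
    have "m \<le> length x" using m xy(2) by blast
    then have l: "?m \<le> length x" using xy(1) by simp
    have ne: "take ?m x \<noteq> []" using xy(1) by simp
    have "take ?m x \<in> dom f" using m l by simp
    then obtain v where v: "f (take ?m x) = Some v" by blast
    have "\<exists>v'. v = True # v'"
      by (rule value_starts_True_prefix[OF f(1) _ v S0_RM_nonempty_values[OF S v ne], of "drop ?m x" y])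
        (simp add: xy(2))
    moreover have "\<exists>t. take ?m x = True # t" using xy(1) by (cases ?m) auto
    ultimately have "rhoF f (take ?m x) = Some v" using v by (auto simp: rho_eq_Some_iff)
    with l show ?thesis by blast
  qed
  then show ?thesis unfolding pflRMfin_iff using ri_morphism_rhoF[OF f(1)] plep_rhoF[OF f(2)] by blast
qed

lemma iotaF_S0_RM:
  assumes S: "f \<in> S0_RM" shows "iotaF f \<in> pflRMfin"
proof -
  obtain m where f: "ri_morphism f" "plep f" and m: "dom f = {x. m \<le> length x}"
    using S by (auto simp: S0_RM_def tflRMfin_iff)
  have "m - 1 \<le> length z \<and> take (m - 1) z \<in> dom (iotaF f)" if z: "z \<in> dom (iotaF f)" for z
  proof -
    obtain y where y: "f (True # z) = Some (True # y)" using z by (auto simp: iotaF_iff)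
    then have "m \<le> length (True # z)" using m by blast
    then have l: "m - 1 \<le> length z" by simp
    then have "True # take (m - 1) z \<in> dom f" using m by simp
    then obtain v where v: "f (True # take (m - 1) z) = Some v" by blast
    have "\<exists>v'. v = True # v'"
      by (rule value_starts_True_prefix[OF f(1) _ v S0_RM_nonempty_values[OF S v], of "drop (m - 1) z" y])
        (simp_all add: y)
    with v l show ?thesis using iotaF_iff by blast
  qed
  then show ?thesis unfolding pflRMfin_iff using ri_morphism_iotaF[OF f(1)] plep_iotaF[OF f(2)] by blast
qed

section \<open>Completion by a sink\<close>

text \<open>The map \<open>pu \<mapsto> 0\<^sup>k\<^sup>+\<^sup>1u\<close> for all words \<open>p\<close> of length \<open>N\<close>.  For \<open>N = k = 0\<close> it is \<open>z \<mapsto> 0z\<close>.\<close>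

definition sink :: "nat \<Rightarrow> nat \<Rightarrow> (bool list \<rightharpoonup> bool list)" where
  "sink N k z = (if N \<le> length z then Some (False # replicate k False @ drop N z) else None)"

lemma sink_append: "sink N k z = Some y \<Longrightarrow> sink N k (z @ u) = Some (y @ u)"
  by (auto simp: sink_def split: if_splits)

text \<open>The parameters of the sink are kept separate on the words \<open>0z\<close> and \<open>1z\<close>: the members of \<open>F\<^sub>0\<close>
  have to be the identity on the former, those of \<open>S\<^sub>0\<close> must give both the same lengths.\<close>

definition sink_completion ::
  "nat \<Rightarrow> nat \<Rightarrow> nat \<Rightarrow> nat \<Rightarrow> (bool list \<rightharpoonup> bool list) \<Rightarrow> (bool list \<rightharpoonup> bool list)" where
  "sink_completion M j N k g w = (case w of [] \<Rightarrow> None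
     | b # z \<Rightarrow> if \<not> b then sink M j z else if z \<in> dom g then Some (True # the (g z)) else sink N k z)"

lemma sink_completion_simps:
  "sink_completion M j N k g [] = None"
  "sink_completion M j N k g (False # z) = sink M j z"
  "g z = Some y \<Longrightarrow> sink_completion M j N k g (True # z) = Some (True # y)"
  "g z = None \<Longrightarrow> sink_completion M j N k g (True # z) = sink N k z"
  by (auto simp: sink_completion_def)

lemma iotaF_sink_completion: "iotaF (sink_completion M j N k g) = g"
proof (rule map_eqI)
  show "iotaF (sink_completion M j N k g) z = Some y \<longleftrightarrow> g z = Some y" for z y
    unfolding iotaF_iff by (cases "g z") (auto simp: sink_completion_simps sink_def)
qed

text \<open>The sink must not be defined on a word outside the domain of \<open>g\<close> that has an extension inside;
  for this, \<open>N\<close> has to be a length that determines the domain.\<close>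

lemma ri_morphism_sink_completion:
  assumes g: "ri_morphism g" and N: "\<And>z. z \<in> dom g \<Longrightarrow> N \<le> length z \<Longrightarrow> take N z \<in> dom g"
  shows "ri_morphism (sink_completion M j N k g)"
proof (rule ri_morphismI)
  fix x y u assume xy: "sink_completion M j N k g x = Some y"
  then obtain b z where x: "x = b # z" by (cases x) (auto simp: sink_completion_simps)
  show "sink_completion M j N k g (x @ u) = Some (y @ u)"
  proof (cases b)
    case False
    with xy x show ?thesis by (simp add: sink_completion_simps sink_append)
  next
    case True
    show ?thesis
    proof (cases "g z")
      case (Some v)
      with xy x True show ?thesis
        by (auto simp: sink_completion_simps ri_morphism_append[OF g Some])
    next
      case None
      with xy x True have s: "sink N k z = Some y" by (simp add: sink_completion_simps)
      then have l: "N \<le> length z" by (simp add: sink_def split: if_splits)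
      have "z @ u \<notin> dom g"
      proof
        assume "z @ u \<in> dom g"
        with N[of "z @ u"] l have "take N z \<in> dom g" by simp
        then have "z \<in> dom g" using dom_append[OF g, of "take N z" "drop N z"] by simp
        with None show False by blast
      qed
      with x True sink_append[OF s, of u] show ?thesis by (simp add: sink_completion_simps domIff)
    qed
  qed
qed

lemma iotaF_F0_RM: "iotaF ` F0_RM = RMfin"
proof (intro equalityI subsetI)
  fix g assume "g \<in> iotaF ` F0_RM"
  then show "g \<in> RMfin" using iotaF_RMfin by (auto simp: F0_RM_def totRMfin_def)
next
  fix g assume "g \<in> RMfin"
  then obtain N where g: "ri_morphism g"
    and N: "\<And>x. x \<in> dom g \<Longrightarrow> N \<le> length x \<Longrightarrow> take N x \<in> dom g" unfolding RMfin_iff by blast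
  let ?f = "sink_completion 0 0 N 0 g"
  have "x \<in> dom ?f" if "Suc N \<le> length x" for x
  proof -
    from that obtain b z where x: "x = b # z" "N \<le> length z" by (cases x) auto
    show ?thesis
      by (cases b; cases "g z") (use x in \<open>auto simp: sink_completion_simps sink_def\<close>)
  qed
  then have "?f \<in> totRMfin"
    unfolding totRMfin_iff using ri_morphism_sink_completion[OF g N] by blast
  then have "?f \<in> F0_RM" by (simp add: F0_RM_def sink_completion_simps sink_def)
  then show "g \<in> iotaF ` F0_RM" using iotaF_sink_completion by (metis image_eqI)
qed

text \<open>With domain code inside \<open>{0,1}\<^sup>m\<close>, the values at words of length \<open>m\<close> all have the same length
  \<open>k\<close>.  Sending the words of length \<open>m + 1\<close> outside the copy of the code to \<open>0\<^sup>k\<^sup>+\<^sup>1\<close> therefore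
  preserves equality of lengths.\<close>

lemma iotaF_image_S0_RM: "iotaF ` S0_RM = pflRMfin"
proof (intro equalityI subsetI)
  fix g assume "g \<in> iotaF ` S0_RM"
  then show "g \<in> pflRMfin" using iotaF_S0_RM by blast
next
  fix g assume "g \<in> pflRMfin"
  then obtain m where g: "ri_morphism g" "plep g"
    and m: "\<And>x. x \<in> dom g \<Longrightarrow> m \<le> length x \<and> take m x \<in> dom g" unfolding pflRMfin_iff by blast
  obtain k where k: "\<And>x y. length x = m \<Longrightarrow> g x = Some y \<Longrightarrow> length y = k"
  proof (cases "\<exists>x0 y0. length x0 = m \<and> g x0 = Some y0")
    case True
    then obtain x0 y0 where x0: "length x0 = m" "g x0 = Some y0" by blast
    show thesis
    proof (rule that)
      show "length y = length y0" if "length x = m" "g x = Some y" for x y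
        using plepD[OF g(2) that(2) x0(2)] that(1) x0(1) by simp
    qed
  qed (use that in blast)
  let ?f = "sink_completion m k m k g"
  have ri: "ri_morphism ?f" using ri_morphism_sink_completion[OF g(1)] m by blast
  have gl: "length v = k + (length z - m)" if "g z = Some v" for z v
  proof -
    have "m \<le> length z" "take m z \<in> dom g" using m[of z] that by auto
    then obtain v' where v': "g (take m z) = Some v'" by blast
    with \<open>m \<le> length z\<close> have "length v' = k" using k[of "take m z" v'] by simp
    moreover have "v = v' @ drop m z" using ri_morphism_long[OF g(1) v'] that by simp
    ultimately show ?thesis by simp
  qed
  have sl: "length y = Suc (k + (length z - m))" if "sink m k z = Some y" for z y
    using that by (auto simp: sink_def split: if_splits)
  have fl: "length y = k + (length x - m)" if xy: "?f x = Some y" for x y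
  proof (cases x)
    case (Cons b z)
    show ?thesis
    proof (cases "b \<and> z \<in> dom g")
      case True
      then obtain v where v: "g z = Some v" by blast
      with xy Cons True have "y = True # v" by (simp add: sink_completion_simps)
      moreover have "m \<le> length z" using m True by blast
      ultimately show ?thesis using gl[OF v] Cons by simp
    next
      case False
      with xy Cons have s: "sink m k z = Some y"
        by (cases b) (simp_all add: sink_completion_simps domIff)
      then have "m \<le> length z" by (simp add: sink_def split: if_splits)
      with sl[OF s] Cons show ?thesis by simp
    qed
  qed (use xy in \<open>simp add: sink_completion_simps\<close>)
  have "plep ?f"
  proof (rule plepI)
    fix x x' y y' assume "?f x = Some y" "?f x' = Some y'" "length x = length x'"
    then show "length y = length y'" using fl[of x y] fl[of x' y'] by simp
  qed
  moreover have "x \<in> dom ?f \<longleftrightarrow> Suc m \<le> length x" for x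
  proof (cases x)
    case (Cons b z)
    show ?thesis
    proof (cases "b \<and> z \<in> dom g")
      case True
      then obtain v where "g z = Some v" by blast
      with Cons True have "?f x = Some (True # v)" by (simp add: sink_completion_simps)
      then show ?thesis using m[of z] True Cons by auto
    next
      case False
      with Cons have "?f x = sink m k z"
        by (cases b) (simp_all add: sink_completion_simps domIff)
      with Cons show ?thesis by (simp add: sink_def domIff)
    qed
  qed (simp add: sink_completion_simps domIff)
  then have "dom ?f = {x. Suc m \<le> length x}" by blast
  ultimately have "?f \<in> tflRMfin" unfolding tflRMfin_iff using ri by blast
  then have "?f \<in> S0_RM"
    by (auto simp: S0_RM_def sink_completion_simps sink_def split: if_splits)
  then show "g \<in> iotaF ` S0_RM" using iotaF_sink_completion by (metis image_eqI)
qed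

section \<open>From finite to infinite words\<close>

lemma on_ends_nonempty:
  assumes f: "ri_morphism f" and "on_ends f w = Some v"
  obtains x y z where "f x = Some y" "w = x @- z" "v = y @- z" "x \<noteq> []" "y \<noteq> []"
proof -
  obtain x y z where xyz: "f x = Some y" "w = x @- z" "v = y @- z"
    using assms on_ends_eq_Some_iff[OF f] by blast
  have "f (x @ [shd z]) = Some (y @ [shd z])" using ri_morphism_append[OF f xyz(1)] .
  moreover have "w = (x @ [shd z]) @- stl z" "v = (y @ [shd z]) @- stl z" using xyz by simp_all
  ultimately show thesis using that by blast
qed

lemma on_endsI: "ri_morphism f \<Longrightarrow> f x = Some y \<Longrightarrow> on_ends f (x @- z) = Some (y @- z)"
  using on_ends_eq_Some_iff by blast

lemma on_endsI_Cons: "ri_morphism f \<Longrightarrow> f (b # x) = Some y \<Longrightarrow> on_ends f (b ## x @- z) = Some (y @- z)"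
  using on_endsI[of f "b # x" y z] by simp

lemma rhoI_on_ends:
  assumes f: "ri_morphism f"
  shows "rhoI (on_ends f) = on_ends (rhoF f)"
proof (rule map_eqI)
  fix w v
  show "rhoI (on_ends f) w = Some v \<longleftrightarrow> on_ends (rhoF f) w = Some v"
  proof
    assume "rhoI (on_ends f) w = Some v"
    then obtain w' v' where e: "on_ends f w = Some v" "w = True ## w'" "v = True ## v'"
      by (auto simp: rho_eq_Some_iff)
    obtain x y z where xyz: "f x = Some y" "w = x @- z" "v = y @- z" "x \<noteq> []" "y \<noteq> []"
      using on_ends_nonempty[OF f e(1)] .
    then have "rhoF f x = Some y" using e
      by (cases x; cases y) (auto simp: rho_eq_Some_iff)
    with xyz show "on_ends (rhoF f) w = Some v" using on_endsI[OF ri_morphism_rhoF[OF f]] by blast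
  next
    assume "on_ends (rhoF f) w = Some v"
    then obtain x y z where "rhoF f x = Some y" "w = x @- z" "v = y @- z"
      unfolding on_ends_eq_Some_iff[OF ri_morphism_rhoF[OF f]] by blast
    then show "rhoI (on_ends f) w = Some v"
      using on_endsI[OF f, of x y z] by (auto simp: rho_eq_Some_iff)
  qed
qed

lemma inj_SCons: "inj ((##) True)" by (simp add: inj_def)

lemmas iotaI_iff = iota_eq_Some_iff[OF inj_SCons]

lemma iotaI_on_ends:
  assumes f: "ri_morphism f"
  shows "iotaI (on_ends f) = on_ends (iotaF f)"
proof (rule map_eqI)
  fix w v
  show "iotaI (on_ends f) w = Some v \<longleftrightarrow> on_ends (iotaF f) w = Some v"
  proof
    assume "iotaI (on_ends f) w = Some v"
    then have e: "on_ends f (True ## w) = Some (True ## v)" by (simp add: iotaI_iff)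
    obtain x y z where xyz: "f x = Some y" "True ## w = x @- z" "True ## v = y @- z" "x \<noteq> []" "y \<noteq> []"
      using on_ends_nonempty[OF f e] .
    then obtain x' y' where "x = True # x'" "y = True # y'" by (cases x; cases y) auto
    with xyz have "iotaF f x' = Some y'" "w = x' @- z" "v = y' @- z" by (auto simp: iotaF_iff)
    then show "on_ends (iotaF f) w = Some v" using on_endsI[OF ri_morphism_iotaF[OF f]] by blast
  next
    assume "on_ends (iotaF f) w = Some v"
    then obtain x y z where "iotaF f x = Some y" "w = x @- z" "v = y @- z"
      unfolding on_ends_eq_Some_iff[OF ri_morphism_iotaF[OF f]] by blast
    then show "iotaI (on_ends f) w = Some v"
      using on_endsI_Cons[OF f, of True x "True # y" z] by (auto simp: iotaI_iff iotaF_iff)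
  qed
qed

lemma on_ends_image_closed:
  assumes A: "comp_closed A" and ri: "\<And>f. f \<in> A \<Longrightarrow> ri_morphism f"
  shows "comp_closed (on_ends ` A)"
  unfolding comp_closed_def
proof (intro conjI ballI)
  show "Some \<in> on_ends ` A" using A on_ends_Some by (metis comp_closed_def image_eqI)
  fix f g assume "f \<in> on_ends ` A" "g \<in> on_ends ` A"
  then obtain f' g' where "f' \<in> A" "g' \<in> A" "f = on_ends f'" "g = on_ends g'" by blast
  with A show "f \<circ>\<^sub>m g \<in> on_ends ` A"
    using ri on_ends_comp[of f' g'] by (simp add: comp_closed_def) (metis image_eqI)
qed

text \<open>Deleting the words shorter than \<open>N\<close> from the domain changes it by finitely many words.\<close>

lemma restrict_long:
  assumes f: "ri_morphism f"
  defines "f' \<equiv> \<lambda>N x. if N \<le> length x then f x else None"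
  shows "ri_morphism (f' N)" "on_ends (f' N) = on_ends f" "plep f \<Longrightarrow> plep (f' N)"
proof -
  show ri: "ri_morphism (f' N)"
    by (rule ri_morphismI) (auto simp: f'_def ri_morphism_append[OF f] split: if_splits)
  show "on_ends (f' N) = on_ends f"
  proof (rule map_eqI)
    fix w v
    show "on_ends (f' N) w = Some v \<longleftrightarrow> on_ends f w = Some v"
    proof
      assume "on_ends (f' N) w = Some v"
      then obtain x y z where "f' N x = Some y" "w = x @- z" "v = y @- z"
        unfolding on_ends_eq_Some_iff[OF ri] by blast
      then show "on_ends f w = Some v" using on_endsI[OF f, of x y z]
        by (auto simp: f'_def split: if_splits)
    next
      assume "on_ends f w = Some v"
      then obtain x y z where xyz: "f x = Some y" "w = x @- z" "v = y @- z"
        unfolding on_ends_eq_Some_iff[OF f] by blast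
      then have "f' N (x @ stake N z) = Some (y @ stake N z)"
        by (simp add: f'_def ri_morphism_append[OF f])
      from on_endsI[OF ri this, of "sdrop N z"] xyz(2,3)
      show "on_ends (f' N) w = Some v" by (simp add: stake_sdrop)
    qed
  qed
  show "plep (f' N)" if "plep f"
  proof (rule plepI)
    fix x x' y y' assume "f' N x = Some y" "f' N x' = Some y'" "length x = length x'"
    then show "length y = length y'"
      using plepD[OF that, of x y x' y'] by (simp add: f'_def split: if_splits)
  qed
qed

lemma RMfin_subsets:
  "totRMfin \<subseteq> RMfin" "plepRMfin \<subseteq> RMfin" "tlepRMfin \<subseteq> RMfin" "pflRMfin \<subseteq> plepRMfin"
  "tflRMfin \<subseteq> tlepRMfin"
  by (auto simp: totRMfin_def plepRMfin_def tlepRMfin_def pflRMfin_def tflRMfin_def)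

lemma totM21_eq: "totM21 = on_ends ` totRMfin"
  unfolding totM21_def using RMfin_subsets by (intro represented_by_eq)

lemma plepM21_eq: "plepM21 = on_ends ` pflRMfin"
proof -
  have "on_ends f \<in> on_ends ` pflRMfin" if "f \<in> plepRMfin" for f
  proof -
    from that obtain N where f: "ri_morphism f" "plep f"
      and N: "\<And>x. x \<in> dom f \<Longrightarrow> N \<le> length x \<Longrightarrow> take N x \<in> dom f"
      by (auto simp: plepRMfin_def RMfin_iff)
    let ?f = "\<lambda>x. if N \<le> length x then f x else None"
    have "N \<le> length x \<and> take N x \<in> dom ?f" if "x \<in> dom ?f" for x
      using that N[of x] by (auto simp: dom_def split: if_splits)
    then have "?f \<in> pflRMfin"
      unfolding pflRMfin_iff using restrict_long[OF f(1), of N] f(2) by blast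
    then show ?thesis unfolding restrict_long(2)[OF f(1), of N, symmetric] by (rule imageI)
  qed
  then have "on_ends ` plepRMfin = on_ends ` pflRMfin" using RMfin_subsets(4) by blast
  then show ?thesis unfolding plepM21_def using represented_by_eq RMfin_subsets(2) by metis
qed

lemma tlepM21_eq: "tlepM21 = on_ends ` tflRMfin"
proof -
  have "on_ends f \<in> on_ends ` tflRMfin" if "f \<in> tlepRMfin" for f
  proof -
    from that obtain N where f: "ri_morphism f" "plep f" and N: "\<And>x. N \<le> length x \<Longrightarrow> x \<in> dom f"
      by (auto simp: tlepRMfin_def totRMfin_iff)
    let ?f = "\<lambda>x. if N \<le> length x then f x else None"
    have "dom ?f = {x. N \<le> length x}" using N by (auto simp: dom_def split: if_splits)
    then have "?f \<in> tflRMfin"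
      unfolding tflRMfin_iff using restrict_long[OF f(1), of N] f(2) by blast
    then show ?thesis unfolding restrict_long(2)[OF f(1), of N, symmetric] by (rule imageI)
  qed
  then have "on_ends ` tlepRMfin = on_ends ` tflRMfin" using RMfin_subsets(5) by blast
  then show ?thesis unfolding tlepM21_def using represented_by_eq RMfin_subsets(3) by metis
qed

lemma totRMfin_ri: "f \<in> totRMfin \<Longrightarrow> ri_morphism f"
  by (simp add: totRMfin_iff)

lemma tflRMfin_tot: "f \<in> tflRMfin \<Longrightarrow> f \<in> totRMfin"
  by (simp add: tflRMfin_def tlepRMfin_def)

lemma on_ends_total:
  assumes f: "f \<in> totRMfin"
  shows "\<exists>n y. f (b # stake n z) = Some y \<and> on_ends f (b ## z) = Some (y @- sdrop n z)"
proof -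
  obtain N where ri: "ri_morphism f" and N: "\<And>x. N \<le> length x \<Longrightarrow> x \<in> dom f"
    using f unfolding totRMfin_iff by blast
  have "b # stake N z \<in> dom f" by (rule N) simp
  then obtain y where y: "f (b # stake N z) = Some y" by blast
  from on_endsI_Cons[OF ri y, of "sdrop N z"] y show ?thesis by (metis stake_sdrop)
qed

text \<open>In the direction from infinite to finite words, it is essential that the condition on the
  action at \<open>0zw\<close> is available for all \<open>w\<close>: it determines the value at \<open>0z\<close>.\<close>

lemma F0_M_eq: "F0_M = on_ends ` F0_RM"
proof (intro equalityI subsetI)
  fix h assume "h \<in> F0_M"
  then obtain f where f: "f \<in> totRMfin" "h = on_ends f"
    and h: "\<And>z. on_ends f (False ## z) = Some (False ## z)" by (auto simp: F0_M_def totM21_eq)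
  have "y = False # z" if "f (False # z) = Some y" for z y
    by (rule shift_right_inj)
      (use on_endsI_Cons[OF totRMfin_ri[OF f(1)] that] h in \<open>simp add: eq_commute\<close>)
  then have "f \<in> F0_RM" using f(1) by (auto simp: F0_RM_def)
  with f show "h \<in> on_ends ` F0_RM" by blast
next
  fix h assume "h \<in> on_ends ` F0_RM"
  then obtain f where f: "f \<in> totRMfin" "h = on_ends f"
    and F: "\<And>z. False # z \<in> dom f \<Longrightarrow> f (False # z) = Some (False # z)" by (auto simp: F0_RM_def)
  have "on_ends f (False ## z) = Some (False ## z)" for z
  proof -
    obtain n y where "f (False # stake n z) = Some y" "on_ends f (False ## z) = Some (y @- sdrop n z)"
      using on_ends_total[OF f(1)] by blast
    moreover from this(1) have "y = False # stake n z" using F[of "stake n z"] by auto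
    ultimately show ?thesis by (simp add: stake_sdrop)
  qed
  with f show "h \<in> F0_M" by (simp add: F0_M_def totM21_eq)
qed

lemma S0_M_eq: "S0_M = on_ends ` S0_RM"
proof (intro equalityI subsetI)
  fix h assume "h \<in> S0_M"
  then obtain f where f: "f \<in> tflRMfin" "h = on_ends f"
    and h: "\<And>z. \<exists>y. on_ends f (False ## z) = Some (False ## y)" by (auto simp: S0_M_def tlepM21_eq)
  have "\<exists>y'. y = False # y'" if y: "f (False # z) = Some y" for z y
  proof -
    \<comment> \<open>Continuing with 1 excludes the empty value.\<close>
    have "\<exists>v. y @- (True ## undefined) = False ## v"
      using on_endsI_Cons[OF totRMfin_ri[OF tflRMfin_tot[OF f(1)]] y, of "True ## undefined"]
        h[of "z @- True ## undefined"] by auto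
    then show ?thesis by (cases y) auto
  qed
  then have "f \<in> S0_RM" using f(1) by (auto simp: S0_RM_def)
  with f show "h \<in> on_ends ` S0_RM" by blast
next
  fix h assume "h \<in> on_ends ` S0_RM"
  then obtain f where f: "f \<in> S0_RM" "f \<in> tflRMfin" "h = on_ends f" by (auto simp: S0_RM_def)
  have "\<exists>v. on_ends f (False ## z) = Some (False ## v)" for z
  proof -
    obtain n y where "f (False # stake n z) = Some y" "on_ends f (False ## z) = Some (y @- sdrop n z)"
      using on_ends_total[OF tflRMfin_tot[OF f(2)]] by blast
    moreover from this(1) obtain y' where "y = False # y'" using S0_RM_value[OF f(1)] by blast
    ultimately show ?thesis by simp
  qed
  with f show "h \<in> S0_M" by (simp add: S0_M_def tlepM21_eq)
qed

lemma sink_invariant_reflects_streams: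
  assumes "\<And>z. \<exists>y. f (False ## z) = Some (False ## y)"
  shows "reflects ((##) True) f"
  unfolding reflects_def
proof (intro allI impI)
  fix x y assume xy: "f x = Some (True ## y)"
  obtain b z where x: "x = b ## z" by (cases x)
  with xy assms[of z] show "x \<in> range ((##) True)" by (cases b) auto
qed

section \<open>Injectivity over the total functions\<close>

lemma inj_on_F0_M: "inj_on (iotaI \<circ> rhoI) {f \<in> F0_M. (iotaI \<circ> rhoI) f \<in> totM21}"
proof (rule inj_onI)
  fix f g assume "f \<in> {f \<in> F0_M. (iotaI \<circ> rhoI) f \<in> totM21}" "g \<in> {f \<in> F0_M. (iotaI \<circ> rhoI) f \<in> totM21}"
    and "(iotaI \<circ> rhoI) f = (iotaI \<circ> rhoI) g"
  then have fg: "f \<in> F0_M" "g \<in> F0_M" and t: "iotaI f \<in> totM21" and eq: "iotaI f = iotaI g"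
    by (auto simp: iota_rho[OF inj_SCons])
  from t obtain h where h: "h \<in> totRMfin" "iotaI f = on_ends h" by (auto simp: totM21_eq)
  show "f = g"
  proof
    fix w :: "bool stream"
    obtain b z where w: "w = b ## z" by (cases w)
    show "f w = g w"
    proof (cases b)
      case True
      obtain z' where "iotaI f z = Some z'"
        using on_ends_total[OF h(1), of "shd z" "stl z"] h(2) by auto
      then have "f (True ## z) = Some (True ## z')" "g (True ## z) = Some (True ## z')"
        using eq iotaI_iff by metis+
      with w True show ?thesis by simp
    qed (use fg w in \<open>simp add: F0_M_def\<close>)
  qed
qed

text \<open>If \<open>f(1z)\<close> did not start with 1, then neither would \<open>f(1z0\<^sup>n)\<close>, for any \<open>n\<close>; but \<open>z0\<^sup>n\<close> lies
  in the domain of a total function when \<open>n\<close> is large.\<close>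

lemma iotaF_total_value:
  assumes f: "ri_morphism f" and t: "iotaF f \<in> totRMfin"
  shows "f (True # z) = map_option ((#) True) (iotaF f z)"
proof (cases "f (True # z)")
  case None
  then show ?thesis using iotaF_iff[of f z] by (cases "iotaF f z") auto
next
  case (Some y)
  obtain N where N: "\<And>x. N \<le> length x \<Longrightarrow> x \<in> dom (iotaF f)" using t unfolding totRMfin_iff by blast
  have "z @ replicate N False \<in> dom (iotaF f)" by (rule N) simp
  then obtain v where "f (True # z @ replicate N False) = Some (True # v)" by (auto simp: iotaF_iff)
  then have "y @ replicate N False = True # v"
    using ri_morphism_append[OF f Some, of "replicate N False"] by simp
  then obtain y' where "y = True # y'" by (cases y; cases N) auto
  with Some iotaF_iff[of f z y'] show ?thesis by simp
qed

lemma F0_RM_determined: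
  assumes f: "f \<in> F0_RM" and g: "g \<in> F0_RM" and t: "iotaF f \<in> totRMfin" and eq: "iotaF f = iotaF g"
  shows "(f, g) \<in> fin_equiv \<and> (\<forall>z. f (True # z) = g (True # z))"
proof
  have R: "f \<in> RMfin" "g \<in> RMfin" using f g by (auto simp: F0_RM_def totRMfin_def)
  then have ri: "ri_morphism f" "ri_morphism g" by (auto simp: RMfin_def)
  show "\<forall>z. f (True # z) = g (True # z)"
    using iotaF_total_value[OF ri(1) t] iotaF_total_value[OF ri(2)] t eq by simp
  have "iotaI (on_ends f) = iotaI (on_ends g)" "iotaI (on_ends f) \<in> totM21"
    using eq t by (simp_all add: iotaI_on_ends[OF ri(1)] iotaI_on_ends[OF ri(2)] totM21_eq)
  moreover have "on_ends f \<in> F0_M" "on_ends g \<in> F0_M" using f g by (auto simp: F0_M_eq)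
  ultimately have "on_ends f = on_ends g"
    by - (rule inj_onD[OF inj_on_F0_M], simp_all add: iota_rho[OF inj_SCons])
  then show "(f, g) \<in> fin_equiv" using fin_equiv_iff_on_ends[OF R] by blast
qed

section \<open>The completion theorem\<close>


theorem theorem9p5:
  shows
    "(monoid (comp_monoid totM21 Some) \<and> submonoid F0_M (comp_monoid totM21 Some) \<and>
      rhoI ` F0_M \<subseteq> M21 \<and>
      monoid_epi (comp_monoid F0_M Some) (comp_monoid (rhoI ` F0_M) (rhoI Some)) rhoI \<and>
      monoid_iso (comp_monoid (rhoI ` F0_M) (rhoI Some)) (comp_monoid M21 Some) iotaI \<and>
      monoid_epi (comp_monoid F0_M Some) (comp_monoid M21 Some) (iotaI \<circ> rhoI) \<and>
      inj_on (iotaI \<circ> rhoI) {f \<in> F0_M. (iotaI \<circ> rhoI) f \<in> totM21})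
   \<and>
     (monoid (comp_monoid tlepM21 Some) \<and> submonoid S0_M (comp_monoid tlepM21 Some) \<and>
      rhoI ` S0_M \<subseteq> plepM21 \<and>
      monoid_epi (comp_monoid S0_M Some) (comp_monoid (rhoI ` S0_M) (rhoI Some)) rhoI \<and>
      monoid_iso (comp_monoid (rhoI ` S0_M) (rhoI Some)) (comp_monoid plepM21 Some) iotaI \<and>
      monoid_epi (comp_monoid S0_M Some) (comp_monoid plepM21 Some) (iotaI \<circ> rhoI))
   \<and>
     (monoid (comp_monoid totRMfin Some) \<and> submonoid F0_RM (comp_monoid totRMfin Some) \<and>
      rhoF ` F0_RM \<subseteq> RMfin \<and>
      monoid_epi (comp_monoid F0_RM Some) (comp_monoid (rhoF ` F0_RM) (rhoF Some)) rhoF \<and>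
      monoid_iso (comp_monoid (rhoF ` F0_RM) (rhoF Some)) (comp_monoid RMfin Some) iotaF \<and>
      monoid_epi (comp_monoid F0_RM Some) (comp_monoid RMfin Some) (iotaF \<circ> rhoF) \<and>
      (\<forall>f \<in> F0_RM. \<forall>g \<in> F0_RM. (iotaF \<circ> rhoF) f \<in> totRMfin \<and> (iotaF \<circ> rhoF) f = (iotaF \<circ> rhoF) g \<longrightarrow>
         (f, g) \<in> fin_equiv \<and> (\<forall>z. f (True # z) = g (True # z))))
   \<and>
     (monoid (comp_monoid tflRMfin Some) \<and> submonoid S0_RM (comp_monoid tflRMfin Some) \<and>
      rhoF ` S0_RM \<subseteq> pflRMfin \<and>
      monoid_epi (comp_monoid S0_RM Some) (comp_monoid (rhoF ` S0_RM) (rhoF Some)) rhoF \<and>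
      monoid_iso (comp_monoid (rhoF ` S0_RM) (rhoF Some)) (comp_monoid pflRMfin Some) iotaF \<and>
      monoid_epi (comp_monoid S0_RM Some) (comp_monoid pflRMfin Some) (iotaF \<circ> rhoF))"
proof (intro conjI)
  have riF: "ri_morphism f" if "f \<in> F0_RM" for f using that by (simp add: F0_RM_def totRMfin_iff)
  have riS: "ri_morphism f" if "f \<in> S0_RM" for f using that by (simp add: S0_RM_def tflRMfin_iff)
  have F0M: "comp_closed F0_M" unfolding F0_M_eq using F0_RM_closed riF by (rule on_ends_image_closed)
  have S0M: "comp_closed S0_M" unfolding S0_M_eq using S0_RM_closed riS by (rule on_ends_image_closed)
  have reflF: "reflects ((#) True) f" if "f \<in> F0_RM" for f
    using that riF by (intro sink_invariant_reflects_words) (auto simp: F0_RM_def)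
  have reflS: "reflects ((#) True) f" if "f \<in> S0_RM" for f
    using that riS by (intro sink_invariant_reflects_words) (auto simp: S0_RM_def)
  have reflFM: "reflects ((##) True) f" if "f \<in> F0_M" for f
    using that by (intro sink_invariant_reflects_streams) (auto simp: F0_M_def)
  have reflSM: "reflects ((##) True) f" if "f \<in> S0_M" for f
    using that by (intro sink_invariant_reflects_streams) (auto simp: S0_M_def)
  have imF: "iotaI ` F0_M = M21"
    unfolding F0_M_eq M21_eq iotaF_F0_RM[symmetric] image_image
    using iotaI_on_ends[OF riF] by (intro image_cong) auto
  have imS: "iotaI ` S0_M = plepM21"
    unfolding S0_M_eq plepM21_eq iotaF_image_S0_RM[symmetric] image_image
    using iotaI_on_ends[OF riS] by (intro image_cong) auto
  note FM = corner_epi[OF inj_SCons F0M reflFM imF]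
  note SM = corner_epi[OF inj_SCons S0M reflSM imS]
  note F = corner_epi[OF inj_Cons F0_RM_closed reflF iotaF_F0_RM]
  note S = corner_epi[OF inj_Cons S0_RM_closed reflS iotaF_image_S0_RM]
  note [simp] = iota_rho[OF inj_Cons]

  have "comp_closed totM21"
    unfolding totM21_eq using totRMfin_closed totRMfin_ri by (rule on_ends_image_closed)
  then show "monoid (comp_monoid totM21 Some)" by (rule comp_closed_monoid)
  show "submonoid F0_M (comp_monoid totM21 Some)"
    using F0M by (rule comp_closed_submonoid) (auto simp: F0_M_def)
  show "rhoI ` F0_M \<subseteq> M21"
    using rhoF_RMfin riF by (auto simp: F0_M_eq M21_eq rhoI_on_ends F0_RM_def totRMfin_def)
  show "monoid_epi (comp_monoid F0_M Some) (comp_monoid (rhoI ` F0_M) (rhoI Some)) rhoI"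
    "monoid_iso (comp_monoid (rhoI ` F0_M) (rhoI Some)) (comp_monoid M21 Some) iotaI"
    "monoid_epi (comp_monoid F0_M Some) (comp_monoid M21 Some) (iotaI \<circ> rhoI)"
    using FM by blast+
  show "inj_on (iotaI \<circ> rhoI) {f \<in> F0_M. (iotaI \<circ> rhoI) f \<in> totM21}" by (rule inj_on_F0_M)

  have "comp_closed tlepM21"
    unfolding tlepM21_eq using tflRMfin_closed totRMfin_ri[OF tflRMfin_tot] by (rule on_ends_image_closed)
  then show "monoid (comp_monoid tlepM21 Some)" by (rule comp_closed_monoid)
  show "submonoid S0_M (comp_monoid tlepM21 Some)"
    using S0M by (rule comp_closed_submonoid) (auto simp: S0_M_def)
  show "rhoI ` S0_M \<subseteq> plepM21"
    using rhoF_S0_RM riS by (auto simp: S0_M_eq plepM21_eq rhoI_on_ends)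
  show "monoid_epi (comp_monoid S0_M Some) (comp_monoid (rhoI ` S0_M) (rhoI Some)) rhoI"
    "monoid_iso (comp_monoid (rhoI ` S0_M) (rhoI Some)) (comp_monoid plepM21 Some) iotaI"
    "monoid_epi (comp_monoid S0_M Some) (comp_monoid plepM21 Some) (iotaI \<circ> rhoI)"
    using SM by blast+

  show "monoid (comp_monoid totRMfin Some)" using totRMfin_closed by (rule comp_closed_monoid)
  show "submonoid F0_RM (comp_monoid totRMfin Some)"
    using F0_RM_closed by (rule comp_closed_submonoid) (auto simp: F0_RM_def)
  show "rhoF ` F0_RM \<subseteq> RMfin" using rhoF_RMfin by (auto simp: F0_RM_def totRMfin_def)
  show "monoid_epi (comp_monoid F0_RM Some) (comp_monoid (rhoF ` F0_RM) (rhoF Some)) rhoF"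
    "monoid_iso (comp_monoid (rhoF ` F0_RM) (rhoF Some)) (comp_monoid RMfin Some) iotaF"
    "monoid_epi (comp_monoid F0_RM Some) (comp_monoid RMfin Some) (iotaF \<circ> rhoF)"
    using F by blast+
  show "\<forall>f \<in> F0_RM. \<forall>g \<in> F0_RM. (iotaF \<circ> rhoF) f \<in> totRMfin \<and> (iotaF \<circ> rhoF) f = (iotaF \<circ> rhoF) g \<longrightarrow>
         (f, g) \<in> fin_equiv \<and> (\<forall>z. f (True # z) = g (True # z))"
    by (intro ballI impI F0_RM_determined) auto

  show "monoid (comp_monoid tflRMfin Some)" using tflRMfin_closed by (rule comp_closed_monoid)
  show "submonoid S0_RM (comp_monoid tflRMfin Some)"
    using S0_RM_closed by (rule comp_closed_submonoid) (auto simp: S0_RM_def)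
  show "rhoF ` S0_RM \<subseteq> pflRMfin" using rhoF_S0_RM by blast
  show "monoid_epi (comp_monoid S0_RM Some) (comp_monoid (rhoF ` S0_RM) (rhoF Some)) rhoF"
    "monoid_iso (comp_monoid (rhoF ` S0_RM) (rhoF Some)) (comp_monoid pflRMfin Some) iotaF"
    "monoid_epi (comp_monoid S0_RM Some) (comp_monoid pflRMfin Some) (iotaF \<circ> rhoF)"
    using S by blast+
qed

end
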